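(* Let $(M,g)$ be an $n$-dimensional $(N(k),\xi)$-semi-Riemannian manifold and let $a_0,\dots,a_7$ be real numbers with $a_0+a_5+a_6\neq 0$. Suppose $M$ is $\mathcal{T}_a$-pseudosymmetric, i.e. $R\cdot\mathcal{T}_a=L_g\,Q(g,\mathcal{T}_a)$ holds on $\mathcal{U}_g=\{x\in M:(\mathcal{T}_a)_x\neq 0\}$ for some smooth function $L_g$ on $\mathcal{U}_g$, with $L_g\neq 0$. Then: 1. If $a_0+a_2+a_3+na_4+a_5+a_6\neq 0$, then either $M$ is an Einstein manifold or $L_g=k$. 2. If $a_0+a_2+a_3+na_4+a_5+a_6=0$, then either $M$ is an $\eta$-Einstein manifold or $L_g=k$.
   Context: $(M,g)$ is an $n$-dimensional semi-Riemannian manifold; $R$ is its curvature tensor (sign convention: constant curvature $c$ means $R(X,Y)Z=c(g(Y,Z)X-g(X,Z)Y)$), $S(Y,Z)=\mathrm{tr}(X\mapsto R(X,Y)Z)$ the Ricci tensor, $Q$ the Ricci operator ($g(QX,Y)=S(X,Y)$), $r$ the scalar curvature. $(N(k),\xi)$-semi-Riemannian manifold: $k$ is a real number and $\xi$ is a non-null unit vector field, $g(\xi,\xi)=\varepsilon\in\{1,-1\}$, lying in the $k$-nullity distribution $N(k):p\mapsto\{Z\in T_pM: R(X,Y)Z=k(g(Y,Z)X-g(X,Z)Y)\text{ for all }X,Y\}$; $\eta(X)=\varepsilon g(X,\xi)$. $M$ is Einstein if $S=\frac{r}{n}g$, and $\eta$-Einstein if $S=\alpha g+\beta\,\eta\otimes\eta$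 for some smooth functions $\alpha,\beta$. For real $a_0,\dots,a_7$, $\mathcal{T}_a(X,Y)Z=a_0R(X,Y)Z+a_1S(Y,Z)X+a_2S(X,Z)Y+a_3S(X,Y)Z+a_4g(Y,Z)QX+a_5g(X,Z)QY+a_6g(X,Y)QZ+a_7r(g(Y,Z)X-g(X,Z)Y)$. For an endomorphism $F$: $(F\cdot\mathcal{T}_a)(U,V)W=F(\mathcal{T}_a(U,V)W)-\mathcal{T}_a(FU,V)W-\mathcal{T}_a(U,FV)W-\mathcal{T}_a(U,V)FW$. $R\cdot\mathcal{T}_a$ is the tensor $(U,V,W;Z,X)\mapsto(R(Z,X)\cdot\mathcal{T}_a)(U,V)W$, and $Q(g,\mathcal{T}_a)(U,V,W;Z,X)=((Z\wedge_g X)\cdot\mathcal{T}_a)(U,V)W$ with $(Z\wedge_g X)Y=g(X,Y)Z-g(Z,Y)X$.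
   Formalization: "Either M is (η-)Einstein or L_g = k" is stated pointwise: at each point the (η-)Einstein equation holds (α, β global smooth functions) or L_g = k there. The global dichotomy fails: L_g is arbitrary where Q(g,T_a) = 0, e.g. on a non-Einstein warped product. *)

theory Defs
  imports "HOL-Analysis.Analysis"
begin

(* All domains of smoothness below are open subsets of finite-dimensional spaces, so that
   derivatives "at x" only depend on the function on the domain, and it suffices to iterate
   directional derivatives. *)

primrec k_smooth_on ::
  "nat \<Rightarrow> 'a::real_normed_vector set \<Rightarrow> ('a \<Rightarrow> 'b::real_normed_vector) \<Rightarrow> bool"
where
  "k_smooth_on 0 D f = continuous_on D f"
| "k_smooth_on (Suc k) D f =
     ((\<forall>x\<in>D. f differentiable (at x)) \<and>
      (\<forall>v. k_smooth_on k D (\<lambda>x. frechet_derivative f (at x) v)))"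

definition smooth_on ::
  "'a::real_normed_vector set \<Rightarrow> ('a \<Rightarrow> 'b::real_normed_vector) \<Rightarrow> bool"
where
  "smooth_on D f \<longleftrightarrow> (\<forall>k. k_smooth_on k D f)"

section \<open>Smooth manifolds\<close>

(* A chart is a pair (U, \<phi>) of a chart domain and a coordinate map; \<phi> is irrelevant outside U. *)
type_synonym ('a, 'n) chart = "'a set \<times> ('a \<Rightarrow> real ^ 'n)"

definition coords_inv :: "('a, 'n) chart \<Rightarrow> real ^ 'n \<Rightarrow> 'a" where
  "coords_inv c = inv_into (fst c) (snd c)"

definition is_chart :: "'a topology \<Rightarrow> ('a, 'n::finite) chart \<Rightarrow> bool" where
  "is_chart M c \<longleftrightarrow>
     openin M (fst c) \<and> open (snd c ` fst c) \<and>
     homeomorphic_map (subtopology M (fst c)) (top_of_set (snd c ` fst c)) (snd c)"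

definition transition :: "('a, 'n) chart \<Rightarrow> ('a, 'n) chart \<Rightarrow> real ^ 'n \<Rightarrow> real ^ 'n" where
  "transition c d = snd d \<circ> coords_inv c"

definition smooth_manifold :: "'a topology \<Rightarrow> ('a, 'n::finite) chart set \<Rightarrow> bool" where
  "smooth_manifold M A \<longleftrightarrow>
     Hausdorff_space M \<and> second_countable M \<and>
     (\<forall>c\<in>A. is_chart M c) \<and> (\<Union>c\<in>A. fst c) = topspace M \<and>
     (\<forall>c\<in>A. \<forall>d\<in>A. smooth_on (snd c ` (fst c \<inter> fst d)) (transition c d))"

definition smooth_function_on ::
  "('a, 'n::finite) chart set \<Rightarrow> 'a set \<Rightarrow> ('a \<Rightarrow> real) \<Rightarrow> bool"
where
  "smooth_function_on A W f \<longleftrightarrow>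
     (\<forall>c\<in>A. smooth_on (snd c ` (fst c \<inter> W)) (f \<circ> coords_inv c))"

(* For every point p a chart around p is singled out, and the tangent space T_p M is identified
   with real ^ 'n through the coordinate frame of that chart at p.  A vector field is thus a
   function 'a \<Rightarrow> real ^ 'n and a (0,2)-tensor field a function
   'a \<Rightarrow> real ^ 'n \<Rightarrow> real ^ 'n \<Rightarrow> real.  As chart_at jumps from point to point, smoothness of such
   objects is expressed through their coordinate representations in the charts of the atlas. *)

definition chart_at :: "('a, 'n) chart set \<Rightarrow> 'a \<Rightarrow> ('a, 'n) chart" where
  "chart_at A p = (SOME c. c \<in> A \<and> p \<in> fst c)"

(* components with respect to d of the tangent vector at p whose components with respect to c
   are v *)
definition coord_change ::
  "('a, 'n::finite) chart \<Rightarrow> ('a, 'n) chart \<Rightarrow> 'a \<Rightarrow> real ^ 'n \<Rightarrow> real ^ 'n"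
where
  "coord_change c d p v = frechet_derivative (transition c d) (at (snd c p)) v"

definition local_vector_field ::
  "('a, 'n::finite) chart set \<Rightarrow> ('a, 'n) chart \<Rightarrow> ('a \<Rightarrow> real ^ 'n) \<Rightarrow> real ^ 'n \<Rightarrow> real ^ 'n"
where
  "local_vector_field A c V x =
     (let p = coords_inv c x in coord_change (chart_at A p) c p (V p))"

definition smooth_vector_field ::
  "('a, 'n::finite) chart set \<Rightarrow> ('a \<Rightarrow> real ^ 'n) \<Rightarrow> bool"
where
  "smooth_vector_field A V \<longleftrightarrow>
     (\<forall>c\<in>A. smooth_on (snd c ` fst c) (local_vector_field A c V))"

type_synonym ('a, 'n) form2 = "'a \<Rightarrow> real ^ 'n \<Rightarrow> real ^ 'n \<Rightarrow> real"

definition local_form2 ::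
  "('a, 'n::finite) chart set \<Rightarrow> ('a, 'n) chart \<Rightarrow> ('a, 'n) form2 \<Rightarrow>
   real ^ 'n \<Rightarrow> real ^ 'n \<Rightarrow> real ^ 'n \<Rightarrow> real"
where
  "local_form2 A c g x u v =
     (let p = coords_inv c x
      in g p (coord_change c (chart_at A p) p u) (coord_change c (chart_at A p) p v))"

section \<open>Semi-Riemannian manifolds and curvature\<close>

definition form_index :: "(real ^ 'n \<Rightarrow> real ^ 'n \<Rightarrow> real) \<Rightarrow> nat" where
  "form_index b = Max {dim W | W. subspace W \<and> (\<forall>w\<in>W. w \<noteq> 0 \<longrightarrow> b w w < 0)}"

definition semi_riemannian_manifold ::
  "'a topology \<Rightarrow> ('a, 'n::finite) chart set \<Rightarrow> ('a, 'n) form2 \<Rightarrow> bool"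
where
  "semi_riemannian_manifold M A g \<longleftrightarrow>
     smooth_manifold M A \<and>
     (\<forall>p\<in>topspace M.
        bilinear (g p) \<and> (\<forall>X Y. g p X Y = g p Y X) \<and>
        (\<forall>X. (\<forall>Y. g p X Y = 0) \<longrightarrow> X = 0)) \<and>
     (\<exists>\<nu>. \<forall>p\<in>topspace M. form_index (g p) = \<nu>) \<and>
     (\<forall>c\<in>A. \<forall>u v. smooth_on (snd c ` fst c) (\<lambda>x. local_form2 A c g x u v))"

(* The Koszul formula for coordinate (constant) vector fields u, v, w. *)
definition christoffel ::
  "('a, 'n::finite) chart set \<Rightarrow> ('a, 'n) form2 \<Rightarrow> ('a, 'n) chart \<Rightarrow>
   real ^ 'n \<Rightarrow> real ^ 'n \<Rightarrow> real ^ 'n \<Rightarrow> real ^ 'n"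
where
  "christoffel A g c x u v =
     (THE w. \<forall>z. 2 * local_form2 A c g x w z =
          frechet_derivative (\<lambda>y. local_form2 A c g y v z) (at x) u
        + frechet_derivative (\<lambda>y. local_form2 A c g y u z) (at x) v
        - frechet_derivative (\<lambda>y. local_form2 A c g y u v) (at x) z)"

definition levi_civita ::
  "('a, 'n::finite) chart set \<Rightarrow> ('a, 'n) form2 \<Rightarrow> ('a, 'n) chart \<Rightarrow>
   (real ^ 'n \<Rightarrow> real ^ 'n) \<Rightarrow> (real ^ 'n \<Rightarrow> real ^ 'n) \<Rightarrow> real ^ 'n \<Rightarrow> real ^ 'n"
where
  "levi_civita A g c X Y x =
     frechet_derivative Y (at x) (X x) + christoffel A g c x (X x) (Y x)"

definition lie_bracket ::
  "(real ^ 'n \<Rightarrow> real ^ 'n) \<Rightarrow> (real ^ 'n \<Rightarrow> real ^ 'n) \<Rightarrow> real ^ 'n \<Rightarrow> real ^ 'n"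
where
  "lie_bracket X Y x = frechet_derivative Y (at x) (X x) - frechet_derivative X (at x) (Y x)"

definition local_curvature ::
  "('a, 'n::finite) chart set \<Rightarrow> ('a, 'n) form2 \<Rightarrow> ('a, 'n) chart \<Rightarrow>
   (real ^ 'n \<Rightarrow> real ^ 'n) \<Rightarrow> (real ^ 'n \<Rightarrow> real ^ 'n) \<Rightarrow> (real ^ 'n \<Rightarrow> real ^ 'n) \<Rightarrow>
   real ^ 'n \<Rightarrow> real ^ 'n"
where
  "local_curvature A g c X Y Z x =
     levi_civita A g c X (levi_civita A g c Y Z) x
   - levi_civita A g c Y (levi_civita A g c X Z) x
   - levi_civita A g c (lie_bracket X Y) Z x"

(* As R is tensorial, R_p(X,Y)Z may be computed by extending the tangent vectors X, Y, Z at p to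
   vector fields with constant components in the chart chart_at A p. *)
definition curvature ::
  "('a, 'n::finite) chart set \<Rightarrow> ('a, 'n) form2 \<Rightarrow> 'a \<Rightarrow>
   real ^ 'n \<Rightarrow> real ^ 'n \<Rightarrow> real ^ 'n \<Rightarrow> real ^ 'n"
where
  "curvature A g p X Y Z =
     local_curvature A g (chart_at A p) (\<lambda>_. X) (\<lambda>_. Y) (\<lambda>_. Z) (snd (chart_at A p) p)"

definition ricci :: "('a, 'n::finite) chart set \<Rightarrow> ('a, 'n) form2 \<Rightarrow> ('a, 'n) form2" where
  "ricci A g p Y Z = trace (matrix (\<lambda>X. curvature A g p X Y Z))"

definition ricci_op ::
  "('a, 'n::finite) chart set \<Rightarrow> ('a, 'n) form2 \<Rightarrow> 'a \<Rightarrow> real ^ 'n \<Rightarrow> real ^ 'n"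
where
  "ricci_op A g p X = (THE W. \<forall>Y. g p W Y = ricci A g p X Y)"

definition scalar_curvature :: "('a, 'n::finite) chart set \<Rightarrow> ('a, 'n) form2 \<Rightarrow> 'a \<Rightarrow> real" where
  "scalar_curvature A g p = trace (matrix (ricci_op A g p))"

section \<open>Nullity distribution\<close>

definition nullity ::
  "('a, 'n::finite) chart set \<Rightarrow> ('a, 'n) form2 \<Rightarrow> real \<Rightarrow> 'a \<Rightarrow> (real ^ 'n) set"
where
  "nullity A g k p =
     {Z. \<forall>X Y. curvature A g p X Y Z = k *\<^sub>R (g p Y Z *\<^sub>R X - g p X Z *\<^sub>R Y)}"

definition N_semi_riemannian_manifold ::
  "'a topology \<Rightarrow> ('a, 'n::finite) chart set \<Rightarrow> ('a, 'n) form2 \<Rightarrow> real \<Rightarrow> real \<Rightarrow>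
   ('a \<Rightarrow> real ^ 'n) \<Rightarrow> bool"
where
  "N_semi_riemannian_manifold M A g k \<epsilon> \<xi> \<longleftrightarrow>
     semi_riemannian_manifold M A g \<and> \<epsilon> \<in> {1, -1} \<and> smooth_vector_field A \<xi> \<and>
     (\<forall>p\<in>topspace M. g p (\<xi> p) (\<xi> p) = \<epsilon> \<and> \<xi> p \<in> nullity A g k p)"

definition eta ::
  "('a, 'n) form2 \<Rightarrow> real \<Rightarrow> ('a \<Rightarrow> real ^ 'n) \<Rightarrow> 'a \<Rightarrow> real ^ 'n \<Rightarrow> real"
where
  "eta g \<epsilon> \<xi> p X = \<epsilon> * g p X (\<xi> p)"

section \<open>Einstein and eta-Einstein conditions at a point\<close>

definition einstein_at :: "('a, 'n::finite) chart set \<Rightarrow> ('a, 'n) form2 \<Rightarrow> 'a \<Rightarrow> bool" where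
  "einstein_at A g p \<longleftrightarrow>
     (\<forall>X Y. ricci A g p X Y = scalar_curvature A g p / real CARD('n) * g p X Y)"

definition eta_einstein_at ::
  "('a, 'n::finite) chart set \<Rightarrow> ('a, 'n) form2 \<Rightarrow> real \<Rightarrow> ('a \<Rightarrow> real ^ 'n) \<Rightarrow>
   ('a \<Rightarrow> real) \<Rightarrow> ('a \<Rightarrow> real) \<Rightarrow> 'a \<Rightarrow> bool"
where
  "eta_einstein_at A g \<epsilon> \<xi> \<alpha> \<beta> p \<longleftrightarrow>
     (\<forall>X Y. ricci A g p X Y = \<alpha> p * g p X Y + \<beta> p * (eta g \<epsilon> \<xi> p X * eta g \<epsilon> \<xi> p Y))"

section \<open>The tensor T_a and pseudosymmetry\<close>

definition T_tensor ::
  "('a, 'n::finite) chart set \<Rightarrow> ('a, 'n) form2 \<Rightarrow> (nat \<Rightarrow> real) \<Rightarrow> 'a \<Rightarrow>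
   real ^ 'n \<Rightarrow> real ^ 'n \<Rightarrow> real ^ 'n \<Rightarrow> real ^ 'n"
where
  "T_tensor A g a p X Y Z =
     a 0 *\<^sub>R curvature A g p X Y Z
   + (a 1 * ricci A g p Y Z) *\<^sub>R X
   + (a 2 * ricci A g p X Z) *\<^sub>R Y
   + (a 3 * ricci A g p X Y) *\<^sub>R Z
   + (a 4 * g p Y Z) *\<^sub>R ricci_op A g p X
   + (a 5 * g p X Z) *\<^sub>R ricci_op A g p Y
   + (a 6 * g p X Y) *\<^sub>R ricci_op A g p Z
   + (a 7 * scalar_curvature A g p) *\<^sub>R (g p Y Z *\<^sub>R X - g p X Z *\<^sub>R Y)"

definition endo_act ::
  "('v \<Rightarrow> 'v) \<Rightarrow> ('v \<Rightarrow> 'v \<Rightarrow> 'v \<Rightarrow> 'v) \<Rightarrow> 'v \<Rightarrow> 'v \<Rightarrow> 'v \<Rightarrow> 'v::real_vector"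
where
  "endo_act F T U V W = F (T U V W) - T (F U) V W - T U (F V) W - T U V (F W)"

definition wedge ::
  "(real ^ 'n \<Rightarrow> real ^ 'n \<Rightarrow> real) \<Rightarrow> real ^ 'n \<Rightarrow> real ^ 'n \<Rightarrow> real ^ 'n \<Rightarrow> real ^ 'n"
where
  "wedge b Z X Y = b X Y *\<^sub>R Z - b Z Y *\<^sub>R X"

definition T_support ::
  "'a topology \<Rightarrow> ('a, 'n::finite) chart set \<Rightarrow> ('a, 'n) form2 \<Rightarrow> (nat \<Rightarrow> real) \<Rightarrow> 'a set"
where
  "T_support M A g a = {p \<in> topspace M. \<exists>X Y Z. T_tensor A g a p X Y Z \<noteq> 0}"

definition T_pseudosymmetric ::
  "'a topology \<Rightarrow> ('a, 'n::finite) chart set \<Rightarrow> ('a, 'n) form2 \<Rightarrow> (nat \<Rightarrow> real) \<Rightarrow>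
   ('a \<Rightarrow> real) \<Rightarrow> bool"
where
  "T_pseudosymmetric M A g a L \<longleftrightarrow>
     smooth_function_on A (T_support M A g a) L \<and>
     (\<forall>p\<in>T_support M A g a. \<forall>U V W Z X.
        endo_act (curvature A g p Z X) (T_tensor A g a p) U V W =
        L p *\<^sub>R endo_act (wedge (g p) Z X) (T_tensor A g a p) U V W)"

end

theory Submission
  imports Defs
begin

text \<open>
  Write \<open>F\<^sub>X = \<xi> \<and> X\<close> for the rotations \<open>Y \<mapsto> g X Y \<xi> - g \<xi> Y X\<close>. Since \<open>\<xi>\<close> lies in the
  \<open>k\<close>-nullity distribution, the pair symmetry of the curvature tensor gives \<open>R(\<xi>, X) = k F\<^sub>X\<close>.
  Hence pseudosymmetry yields \<open>(k - L) F\<^sub>X \<cdot> T = 0\<close>, and at each point where \<open>L \<noteq> k\<close>, as well as at each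
  point where \<open>T\<close> is zero, all \<open>F\<^sub>X\<close> kill \<open>T\<close> (\<open>xi_wedge_invariant\<close>). From here on the argument is
  algebra at a single point. Let \<open>S\<close> be the Ricci form, \<open>Q\<close> the Ricci operator and
  \<open>\<kappa> = k (n - 1)\<close>, so that \<open>Q \<xi> = \<kappa> \<xi>\<close>.

  Contracting the second and third argument of \<open>T\<close> gives
  \<open>(a\<^sub>0 + a\<^sub>2 + a\<^sub>3 + n a\<^sub>4 + a\<^sub>5 + a\<^sub>6) S\<close> plus a multiple of \<open>g\<close>, and contraction preserves the
  invariance. If the coefficient is not zero, \<open>S\<close> is therefore invariant under all \<open>F\<^sub>X\<close>, which
  forces \<open>S = \<kappa> g\<close> (\<open>einstein_from_contraction\<close>).

  Suppose now that the coefficient is zero, and let \<open>H\<close> be the orthogonal complement of \<open>\<xi>\<close>.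
  Evaluating the invariance at \<open>(Z, \<xi>, \<xi>)\<close> shows \<open>(a\<^sub>2 + a\<^sub>3 + a\<^sub>4) (S - \<kappa> g) = 0\<close> on \<open>H\<close>
  (\<open>first_slot\<close>). If \<open>a\<^sub>2 + a\<^sub>3 + a\<^sub>4 = 0\<close>, then \<open>a\<^sub>0 + a\<^sub>5 + a\<^sub>6 = - (n - 1) a\<^sub>4\<close>, so that
  \<open>a\<^sub>4 \<noteq> 0\<close>. The commutators of the \<open>F\<^sub>X\<close> kill \<open>T\<close> too; up to a factor they are the rotations
  \<open>X \<and> Y\<close> of \<open>H\<close>, which annihilate \<open>\<xi>\<close> and hence commute with \<open>U \<mapsto> T(U, \<xi>)\<xi>\<close>, and because of
  \<open>a\<^sub>4 \<noteq> 0\<close> with \<open>Q\<close> (\<open>wedge_commutes_Q\<close>). A symmetric operator that commutes with these rotations is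
  scalar on \<open>H\<close> (\<open>ricci_scalar_on_orthogonal\<close>). In either case \<open>S = \<alpha> g + \<beta> \<eta> \<otimes> \<eta>\<close>, and the trace
  of \<open>Q\<close> determines \<open>\<alpha> = (r - \<kappa>) / (n - 1)\<close> and \<open>\<beta> = \<epsilon> (\<kappa> - \<alpha>)\<close> (\<open>eta_einstein\<close>).

  Two facts about manifolds remain. The curvature tensor has its usual symmetries; in coordinates
  they follow from the Koszul formula and the equality of mixed second derivatives
  (\<open>curvature_form\<close>). And \<open>r\<close> is a smooth function: in a fixed chart it is a rational expression in
  the derivatives of the metric, by Cramer's rule (\<open>scal_smooth\<close>), and it does not depend on the
  chart because the curvature is a tensor (\<open>curvature_transform\<close>).
\<close>

section \<open>Calculus of iterated directional derivatives\<close>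

lemma k_smooth_on_cong:
  assumes "open D" and "\<And>x. x \<in> D \<Longrightarrow> f x = h x" and "k_smooth_on k D f"
  shows "k_smooth_on k D h"
  using assms(2,3)
proof (induction k arbitrary: f h)
  case 0
  then show ?case by (auto cong: continuous_on_cong)
next
  case (Suc k)
  have diff: "f differentiable (at x)" if "x \<in> D" for x
    using Suc.prems(2) that by simp
  have eq: "frechet_derivative f (at x) = frechet_derivative h (at x)" if "x \<in> D" for x
    using frechet_derivative_transform_within_open[OF diff[OF that] \<open>open D\<close> that] Suc.prems(1)
    by blast
  have "h differentiable (at x)" if "x \<in> D" for x
    using diff[OF that] \<open>open D\<close> that Suc.prems(1)
    by (meson differentiable_def has_derivative_transform_within_open)
  moreover have "k_smooth_on k D (\<lambda>x. frechet_derivative h (at x) v)" for v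
    using Suc.IH[of "\<lambda>x. frechet_derivative f (at x) v" "\<lambda>x. frechet_derivative h (at x) v"]
      eq Suc.prems(2) by auto
  ultimately show ?case by simp
qed

lemma k_smooth_on_SucD: "k_smooth_on (Suc k) D f \<Longrightarrow> k_smooth_on k D f"
proof (induction k arbitrary: f)
  case 0
  then show ?case
    by (auto intro!: continuous_at_imp_continuous_on differentiable_imp_continuous_within)
next
  case (Suc k)
  then show ?case by auto
qed

lemma k_smooth_on_const: "k_smooth_on k D (\<lambda>x. c)"
  by (induction k arbitrary: c) auto

lemma k_smooth_on_bounded_linear:
  assumes "bounded_linear F" and "open D" and "k_smooth_on k D f"
  shows "k_smooth_on k D (\<lambda>x. F (f x))"
  using assms(3)
proof (induction k arbitrary: f)
  case 0
  then show ?case using bounded_linear.continuous_on[OF assms(1)] by auto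
next
  case (Suc k)
  have d: "((\<lambda>x. F (f x)) has_derivative (\<lambda>v. F (frechet_derivative f (at x) v))) (at x)"
    if "x \<in> D" for x
    using bounded_linear.has_derivative[OF assms(1)] Suc.prems that frechet_derivative_works
    by fastforce
  have "k_smooth_on k D (\<lambda>x. frechet_derivative (\<lambda>x. F (f x)) (at x) v)" for v
    by (rule k_smooth_on_cong[OF \<open>open D\<close> _ Suc.IH[of "\<lambda>x. frechet_derivative f (at x) v"]])
       (use Suc.prems frechet_derivative_at[OF d] in \<open>auto dest: fun_cong\<close>)
  with d show ?case by (auto simp: differentiable_def)
qed

lemma k_smooth_on_add:
  assumes "open D" and "k_smooth_on k D f" and "k_smooth_on k D h"
  shows "k_smooth_on k D (\<lambda>x. f x + h x)"
  using assms(2,3)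
proof (induction k arbitrary: f h)
  case 0
  then show ?case by (auto intro: continuous_intros)
next
  case (Suc k)
  have d: "((\<lambda>x. f x + h x) has_derivative
      (\<lambda>v. frechet_derivative f (at x) v + frechet_derivative h (at x) v)) (at x)"
    if "x \<in> D" for x
    using Suc.prems that by (auto intro!: has_derivative_add simp: frechet_derivative_works)
  have "k_smooth_on k D (\<lambda>x. frechet_derivative (\<lambda>x. f x + h x) (at x) v)" for v
    by (rule k_smooth_on_cong[OF \<open>open D\<close> _ Suc.IH[of "\<lambda>x. frechet_derivative f (at x) v"
          "\<lambda>x. frechet_derivative h (at x) v"]])
       (use Suc.prems frechet_derivative_at[OF d] in \<open>auto dest: fun_cong\<close>)
  with d show ?case by (auto simp: differentiable_def)
qed

text \<open>
  By the product rule, a derivative of \<open>P (f x) (h x)\<close> is again a sum of terms of the same shape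
  with one factor differentiated; this is what makes the induction on the order go through. The
  factor that is not differentiated enters with one order of smoothness less than it has.
\<close>
lemma k_smooth_on_bilinear:
  assumes "bounded_bilinear P" and "open D" and "k_smooth_on k D f" and "k_smooth_on k D h"
  shows "k_smooth_on k D (\<lambda>x. P (f x) (h x))"
  using assms(3,4)
proof (induction k arbitrary: f h)
  case 0
  then show ?case using bounded_bilinear.continuous_on[OF assms(1)] by auto
next
  case (Suc k)
  have d: "((\<lambda>x. P (f x) (h x)) has_derivative
      (\<lambda>v. P (f x) (frechet_derivative h (at x) v) + P (frechet_derivative f (at x) v) (h x))) (at x)"
    if "x \<in> D" for x
    using Suc.prems that
    by (intro bounded_bilinear.FDERIV[OF assms(1)]) (auto simp: frechet_derivative_works)
  have "k_smooth_on k D (\<lambda>x. frechet_derivative (\<lambda>x. P (f x) (h x)) (at x) v)" for v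
  proof (rule k_smooth_on_cong[OF \<open>open D\<close>])
    show "k_smooth_on k D (\<lambda>x. P (f x) (frechet_derivative h (at x) v) +
                               P (frechet_derivative f (at x) v) (h x))"
      using Suc.prems k_smooth_on_SucD[of k D f] k_smooth_on_SucD[of k D h]
      by (intro k_smooth_on_add \<open>open D\<close> Suc.IH) auto
  qed (use frechet_derivative_at[OF d] in \<open>auto dest: fun_cong\<close>)
  with d show ?case by (auto simp: differentiable_def)
qed

lemma k_smooth_on_inverse:
  fixes f :: "'a::real_normed_vector \<Rightarrow> real"
  assumes "open D" and "\<And>x. x \<in> D \<Longrightarrow> f x \<noteq> 0" and "k_smooth_on k D f"
  shows "k_smooth_on k D (\<lambda>x. inverse (f x))"
  using assms(3)
proof (induction k)
  case 0
  then show ?case using assms(2) by (auto intro!: continuous_intros)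
next
  case (Suc k)
  have d: "((\<lambda>x. inverse (f x)) has_derivative
      (\<lambda>v. - (inverse (f x) * frechet_derivative f (at x) v * inverse (f x)))) (at x)"
    if "x \<in> D" for x
    using Suc.prems that assms(2)
    by (intro Deriv.has_derivative_inverse) (auto simp: frechet_derivative_works)
  have "k_smooth_on k D (\<lambda>x. frechet_derivative (\<lambda>x. inverse (f x)) (at x) v)" for v
  proof (rule k_smooth_on_cong[OF \<open>open D\<close>])
    show "k_smooth_on k D (\<lambda>x. - (inverse (f x) * frechet_derivative f (at x) v * inverse (f x)))"
      using Suc.prems k_smooth_on_SucD[of k D f]
      by (intro k_smooth_on_bounded_linear[OF bounded_linear_minus[OF bounded_linear_ident]]
                k_smooth_on_bilinear[OF bounded_bilinear_mult] \<open>open D\<close> Suc.IH) auto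
  qed (use frechet_derivative_at[OF d] in \<open>auto dest: fun_cong\<close>)
  with d show ?case by (auto simp: differentiable_def)
qed

lemma smooth_on_cong:
  "open D \<Longrightarrow> smooth_on D f \<Longrightarrow> (\<And>x. x \<in> D \<Longrightarrow> f x = h x) \<Longrightarrow> smooth_on D h"
  unfolding smooth_on_def using k_smooth_on_cong by blast

lemma k_smooth_on_subset: "k_smooth_on k D f \<Longrightarrow> D' \<subseteq> D \<Longrightarrow> k_smooth_on k D' f"
  by (induction k arbitrary: f) (auto intro: continuous_on_subset)

lemma smooth_on_subset: "smooth_on D f \<Longrightarrow> D' \<subseteq> D \<Longrightarrow> smooth_on D' f"
  unfolding smooth_on_def using k_smooth_on_subset by blast

lemma smooth_on_differentiable: "smooth_on D f \<Longrightarrow> x \<in> D \<Longrightarrow> f differentiable (at x)"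
  unfolding smooth_on_def by (drule spec[of _ "Suc 0"]) auto

lemma smooth_on_has_derivative:
  "smooth_on D f \<Longrightarrow> x \<in> D \<Longrightarrow> (f has_derivative frechet_derivative f (at x)) (at x)"
  using smooth_on_differentiable frechet_derivative_works by blast

lemma smooth_on_continuous: "smooth_on D f \<Longrightarrow> continuous_on D f"
  unfolding smooth_on_def by (drule spec[of _ 0]) auto

lemma smooth_on_derivative:
  "smooth_on D f \<Longrightarrow> smooth_on D (\<lambda>x. frechet_derivative f (at x) v)"
  unfolding smooth_on_def by (metis k_smooth_on.simps(2))

lemma smooth_on_const: "smooth_on D (\<lambda>x. c)"
  by (simp add: smooth_on_def k_smooth_on_const)

lemma smooth_on_bounded_linear:
  "bounded_linear F \<Longrightarrow> open D \<Longrightarrow> smooth_on D f \<Longrightarrow> smooth_on D (\<lambda>x. F (f x))"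
  by (simp add: smooth_on_def k_smooth_on_bounded_linear)

lemma smooth_on_bilinear:
  "bounded_bilinear P \<Longrightarrow> open D \<Longrightarrow> smooth_on D f \<Longrightarrow> smooth_on D h \<Longrightarrow>
   smooth_on D (\<lambda>x. P (f x) (h x))"
  by (simp add: smooth_on_def k_smooth_on_bilinear)

lemma smooth_on_add:
  "open D \<Longrightarrow> smooth_on D f \<Longrightarrow> smooth_on D h \<Longrightarrow> smooth_on D (\<lambda>x. f x + h x)"
  by (simp add: smooth_on_def k_smooth_on_add)

lemma smooth_on_diff:
  assumes "open D" "smooth_on D f" "smooth_on D h" shows "smooth_on D (\<lambda>x. f x - h x)"
  using smooth_on_add[OF assms(1,2) smooth_on_bounded_linear[OF
      bounded_linear_minus[OF bounded_linear_ident] assms(1,3)]]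
  by simp

lemma smooth_on_sum:
  "open D \<Longrightarrow> (\<And>i. i \<in> I \<Longrightarrow> smooth_on D (f i)) \<Longrightarrow> smooth_on D (\<lambda>x. \<Sum>i\<in>I. f i x)"
  by (induction I rule: infinite_finite_induct) (auto intro: smooth_on_const smooth_on_add)

lemmas smooth_on_mult = smooth_on_bilinear[OF bounded_bilinear_mult]
lemmas smooth_on_scaleR = smooth_on_bilinear[OF bounded_bilinear_scaleR]
lemmas smooth_on_vec_nth = smooth_on_bounded_linear[OF bounded_linear_vec_nth]

lemma smooth_on_prod:
  fixes f :: "'i \<Rightarrow> 'a::real_normed_vector \<Rightarrow> real"
  shows "open D \<Longrightarrow> (\<And>i. i \<in> I \<Longrightarrow> smooth_on D (f i)) \<Longrightarrow> smooth_on D (\<lambda>x. \<Prod>i\<in>I. f i x)"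
  by (induction I rule: infinite_finite_induct) (auto intro: smooth_on_const smooth_on_mult)

lemma smooth_on_divide:
  fixes f h :: "'a::real_normed_vector \<Rightarrow> real"
  assumes "open D" "smooth_on D f" "smooth_on D h" "\<And>x. x \<in> D \<Longrightarrow> h x \<noteq> 0"
  shows "smooth_on D (\<lambda>x. f x / h x)"
proof -
  have "smooth_on D (\<lambda>x. inverse (h x))"
    using assms k_smooth_on_inverse unfolding smooth_on_def by blast
  from smooth_on_mult[OF assms(1,2) this] show ?thesis by (simp add: divide_inverse)
qed

lemma smooth_on_det:
  fixes f :: "'a::real_normed_vector \<Rightarrow> 'n::finite \<Rightarrow> 'n \<Rightarrow> real"
  assumes "open D" "\<And>i j. smooth_on D (\<lambda>x. f x i j)"
  shows "smooth_on D (\<lambda>x. det (\<chi> i j. f x i j))"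
  unfolding det_def
  by (auto intro!: assms smooth_on_sum smooth_on_mult smooth_on_prod smooth_on_const)

lemma smooth_on_vec_lambda:
  fixes f :: "'a::real_normed_vector \<Rightarrow> 'n::finite \<Rightarrow> real"
  assumes "open D" "\<And>i. smooth_on D (\<lambda>x. f x i)"
  shows "smooth_on D (\<lambda>x. \<chi> i. f x i)"
proof -
  have "(\<chi> i. f x i) = (\<Sum>i\<in>UNIV. f x i *\<^sub>R axis i (1::real))" for x
    by (simp add: vec_eq_iff axis_def if_distrib[of "\<lambda>t. _ * t"] cong: if_cong)
  then show ?thesis
    by (simp only:) (intro smooth_on_sum smooth_on_scaleR assms smooth_on_const)
qed

subsection \<open>Symmetry of second derivatives\<close>

text \<open>
  The second difference over the parallelogram spanned by \<open>s u\<close> and \<open>s v\<close> is written as the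
  increment in direction \<open>u\<close> of the increment in direction \<open>v\<close>, and the mean value theorem is
  applied twice. Since the left-hand side is symmetric in \<open>u\<close> and \<open>v\<close>, comparing the two orders
  as \<open>s\<close> tends to 0 gives the equality of mixed derivatives.
\<close>
lemma second_difference:
  fixes f :: "'a::real_normed_vector \<Rightarrow> real"
  assumes f: "smooth_on D f" and s: "s > 0"
    and D: "\<And>a b. 0 \<le> a \<Longrightarrow> a \<le> s \<Longrightarrow> 0 \<le> b \<Longrightarrow> b \<le> s \<Longrightarrow> x + a *\<^sub>R u + b *\<^sub>R v \<in> D"
  shows "\<exists>a b. 0 < a \<and> a < s \<and> 0 < b \<and> b < s \<and>
    f (x + s *\<^sub>R u + s *\<^sub>R v) - f (x + s *\<^sub>R u) - f (x + s *\<^sub>R v) + f x =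
    s\<^sup>2 * frechet_derivative (\<lambda>y. frechet_derivative f (at y) u) (at (x + a *\<^sub>R u + b *\<^sub>R v)) v"
proof -
  have line: "((\<lambda>t. h (y + t *\<^sub>R w)) has_derivative (\<lambda>\<tau>. \<tau> * frechet_derivative h (at (y + t *\<^sub>R w)) w))
      (at t within T)"
    if "smooth_on D h" "y + t *\<^sub>R w \<in> D" for h :: "'a \<Rightarrow> real" and y w t T
  proof -
    note d = smooth_on_has_derivative[OF that]
    have "((\<lambda>t. y + t *\<^sub>R w) has_derivative (\<lambda>\<tau>. \<tau> *\<^sub>R w)) (at t within T)"
      by (auto intro!: derivative_eq_intros)
    from diff_chain_within[OF this has_derivative_at_withinI[OF d]]
    show ?thesis
      using linear_frechet_derivative[OF smooth_on_differentiable[OF that]]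
      by (simp add: o_def linear_cmul)
  qed
  let ?\<phi> = "\<lambda>t. f (x + s *\<^sub>R v + t *\<^sub>R u) - f (x + t *\<^sub>R u)"
  let ?f' = "\<lambda>y. frechet_derivative f (at y) u"
  have "\<exists>a\<in>{0<..<s}. ?\<phi> s - ?\<phi> 0 =
      (\<lambda>\<tau>. \<tau> * ?f' (x + s *\<^sub>R v + a *\<^sub>R u) - \<tau> * ?f' (x + a *\<^sub>R u)) (s - 0)"
  proof (rule mvt_simple[OF s])
    fix t assume "0 \<le> t" "t \<le> s"
    then show "(?\<phi> has_derivative (\<lambda>\<tau>. \<tau> * ?f' (x + s *\<^sub>R v + t *\<^sub>R u) - \<tau> * ?f' (x + t *\<^sub>R u)))
        (at t within {0..s})"
      using D[of t s] D[of t 0] s by (intro has_derivative_diff line f) (auto simp: algebra_simps)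
  qed
  then obtain a where a: "0 < a" "a < s"
    and 1: "?\<phi> s - ?\<phi> 0 = s * (?f' (x + s *\<^sub>R v + a *\<^sub>R u) - ?f' (x + a *\<^sub>R u))"
    by (auto simp: algebra_simps)
  let ?\<psi> = "\<lambda>t. ?f' (x + a *\<^sub>R u + t *\<^sub>R v)"
  have "\<exists>b\<in>{0<..<s}. ?\<psi> s - ?\<psi> 0 =
      (\<lambda>\<tau>. \<tau> * frechet_derivative ?f' (at (x + a *\<^sub>R u + b *\<^sub>R v)) v) (s - 0)"
  proof (rule mvt_simple[OF s])
    fix t assume "0 \<le> t" "t \<le> s"
    then show "(?\<psi> has_derivative (\<lambda>\<tau>. \<tau> * frechet_derivative ?f' (at (x + a *\<^sub>R u + t *\<^sub>R v)) v))
        (at t within {0..s})"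
      using D[of a t] a by (intro line smooth_on_derivative f) auto
  qed
  then obtain b where b: "0 < b" "b < s"
    and 2: "?\<psi> s - ?\<psi> 0 = s * frechet_derivative ?f' (at (x + a *\<^sub>R u + b *\<^sub>R v)) v"
    by auto
  have "?\<phi> s - ?\<phi> 0 = s * (?\<psi> s - ?\<psi> 0)"
    using 1 by (simp add: algebra_simps)
  with 2 a b show ?thesis
    by (intro exI[of _ a] exI[of _ b]) (simp add: power2_eq_square algebra_simps)
qed

lemma symmetric_second_derivative_real:
  fixes f :: "'a::real_normed_vector \<Rightarrow> real"
  assumes D: "open D" and x: "x \<in> D" and f: "smooth_on D f"
  shows "frechet_derivative (\<lambda>y. frechet_derivative f (at y) u) (at x) v =
         frechet_derivative (\<lambda>y. frechet_derivative f (at y) v) (at x) u"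
proof -
  define h where "h u v = (\<lambda>z. frechet_derivative (\<lambda>y. frechet_derivative f (at y) u) (at z) v)"
    for u v
  have cont: "isCont (h u v) x" for u v
    unfolding h_def
    using smooth_on_continuous[OF smooth_on_derivative[OF smooth_on_derivative[OF f]]] D x
    by (simp add: continuous_on_eq_continuous_at)
  have "dist (h u v x) (h v u x) < e" if e: "e > 0" for e
  proof -
    obtain d1 where d1: "d1 > 0" "\<And>z. dist z x < d1 \<Longrightarrow> dist (h u v z) (h u v x) < e/2"
      using cont[of u v] e unfolding continuous_at_eps_delta by (metis half_gt_zero)
    obtain d2 where d2: "d2 > 0" "\<And>z. dist z x < d2 \<Longrightarrow> dist (h v u z) (h v u x) < e/2"
      using cont[of v u] e unfolding continuous_at_eps_delta by (metis half_gt_zero)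
    obtain d3 where d3: "d3 > 0" "\<And>z. dist z x < d3 \<Longrightarrow> z \<in> D"
      using D x by (metis open_dist)
    define d where "d = min d1 (min d2 d3)"
    define s where "s = (d / 2) / (norm u + norm v + 1)"
    have d: "d > 0" using d1 d2 d3 by (simp add: d_def)
    have np: "norm u + norm v + 1 > 0" by (smt (verit) norm_ge_zero)
    have s: "s > 0" using d np by (simp add: s_def)
    have near: "dist (x + a *\<^sub>R u + b *\<^sub>R v) x < d"
      if "0 \<le> a" "a \<le> s" "0 \<le> b" "b \<le> s" for a b
    proof -
      have "dist (x + a *\<^sub>R u + b *\<^sub>R v) x = norm (a *\<^sub>R u + b *\<^sub>R v)"
        by (simp add: dist_norm algebra_simps)
      also have "\<dots> \<le> a * norm u + b * norm v"
        using norm_triangle_ineq[of "a *\<^sub>R u" "b *\<^sub>R v"] that by simp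
      also have "\<dots> \<le> s * norm u + s * norm v"
        using that by (intro add_mono mult_right_mono) auto
      also have "\<dots> \<le> s * (norm u + norm v + 1)"
        using s by (simp add: algebra_simps)
      also have "\<dots> = d / 2" unfolding s_def using np by (subst nonzero_eq_divide_eq[symmetric]) linarith+
      finally show ?thesis using d by simp
    qed
    have inD: "x + a *\<^sub>R u + b *\<^sub>R v \<in> D" if "0 \<le> a" "a \<le> s" "0 \<le> b" "b \<le> s" for a b
      using near[OF that] d3 by (simp add: d_def)
    have inD': "x + a *\<^sub>R v + b *\<^sub>R u \<in> D" if "0 \<le> a" "a \<le> s" "0 \<le> b" "b \<le> s" for a b
      using inD[OF that(3,4,1,2)] by (simp add: algebra_simps)
    obtain a b where ab: "0 < a" "a < s" "0 < b" "b < s"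
      and 1: "f (x + s *\<^sub>R u + s *\<^sub>R v) - f (x + s *\<^sub>R u) - f (x + s *\<^sub>R v) + f x =
        s\<^sup>2 * h u v (x + a *\<^sub>R u + b *\<^sub>R v)"
      using second_difference[OF f s inD] unfolding h_def by blast
    obtain a' b' where ab': "0 < a'" "a' < s" "0 < b'" "b' < s"
      and 2: "f (x + s *\<^sub>R v + s *\<^sub>R u) - f (x + s *\<^sub>R v) - f (x + s *\<^sub>R u) + f x =
        s\<^sup>2 * h v u (x + a' *\<^sub>R v + b' *\<^sub>R u)"
      using second_difference[OF f s inD'] unfolding h_def by blast
    have "s\<^sup>2 * h u v (x + a *\<^sub>R u + b *\<^sub>R v) = s\<^sup>2 * h v u (x + a' *\<^sub>R v + b' *\<^sub>R u)"
      using 1 2 by (simp add: algebra_simps)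
    then have eq: "h u v (x + a *\<^sub>R u + b *\<^sub>R v) = h v u (x + b' *\<^sub>R u + a' *\<^sub>R v)"
      using s by (simp add: algebra_simps)
    have "dist (h u v (x + a *\<^sub>R u + b *\<^sub>R v)) (h u v x) < e/2"
      using near[of a b] ab by (intro d1) (auto simp: d_def)
    moreover have "dist (h v u (x + b' *\<^sub>R u + a' *\<^sub>R v)) (h v u x) < e/2"
      using near[of b' a'] ab' by (intro d2) (auto simp: d_def)
    ultimately show ?thesis
      unfolding eq by (metis dist_commute dist_triangle_half_r)
  qed
  then have "h u v x = h v u x"
    by (metis less_irrefl zero_less_dist_iff)
  then show ?thesis by (simp add: h_def)
qed

lemma symmetric_second_derivative:
  fixes f :: "'a::real_normed_vector \<Rightarrow> 'b::euclidean_space"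
  assumes D: "open D" and x: "x \<in> D" and f: "smooth_on D f"
  shows "frechet_derivative (\<lambda>y. frechet_derivative f (at y) u) (at x) v =
         frechet_derivative (\<lambda>y. frechet_derivative f (at y) v) (at x) u"
proof (rule euclidean_eqI)
  fix b :: 'b
  have comp: "frechet_derivative (\<lambda>y. h y \<bullet> b) (at y) w = frechet_derivative h (at y) w \<bullet> b"
    if "smooth_on D h" "y \<in> D" for h :: "'a \<Rightarrow> 'b" and y w
    using frechet_derivative_at[OF has_derivative_inner_left[OF smooth_on_has_derivative[OF that]]]
    by (metis (mono_tags))
  have fb: "smooth_on D (\<lambda>y. f y \<bullet> b)"
    by (rule smooth_on_bounded_linear[OF bounded_linear_inner_left D f])
  have second: "frechet_derivative (\<lambda>y. frechet_derivative f (at y) u) (at x) v \<bullet> b =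
      frechet_derivative (\<lambda>y. frechet_derivative (\<lambda>y. f y \<bullet> b) (at y) u) (at x) v" for u v
  proof -
    have "frechet_derivative (\<lambda>y. frechet_derivative (\<lambda>y. f y \<bullet> b) (at y) u) (at x) =
          frechet_derivative (\<lambda>y. frechet_derivative f (at y) u \<bullet> b) (at x)"
      by (rule frechet_derivative_transform_within_open[OF
            smooth_on_differentiable[OF smooth_on_derivative[OF fb] x] D x])
         (simp add: comp[OF f])
    then show ?thesis using comp[OF smooth_on_derivative[OF f] x] by simp
  qed
  show "frechet_derivative (\<lambda>y. frechet_derivative f (at y) u) (at x) v \<bullet> b =
        frechet_derivative (\<lambda>y. frechet_derivative f (at y) v) (at x) u \<bullet> b"
    unfolding second by (rule symmetric_second_derivative_real[OF D x fb])
qed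

section \<open>Traces of endomorphisms\<close>

definition tr :: "(real ^ 'n \<Rightarrow> real ^ 'n) \<Rightarrow> real" where
  "tr f = trace (matrix f)"

lemma tr_eq_sum: "tr f = (\<Sum>i\<in>UNIV. f (axis i 1) $ i)"
  by (simp add: tr_def trace_def matrix_def)

lemma tr_add: "tr (\<lambda>x. f x + h x) = tr f + tr h"
  by (simp add: tr_eq_sum sum.distrib)

lemma tr_diff: "tr (\<lambda>x. f x - h x) = tr f - tr h"
  by (simp add: tr_eq_sum sum_subtractf)

lemma tr_scaleR: "tr (\<lambda>x. c *\<^sub>R f x) = c * tr f"
  by (simp add: tr_eq_sum sum_distrib_left)

lemma tr_ident: "tr (\<lambda>x::real^'n. x) = real CARD('n)"
  by (simp add: tr_eq_sum)

lemma linear_eq_sum_axis: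
  fixes \<phi> :: "real ^ 'n \<Rightarrow> 'b::real_vector"
  assumes "linear \<phi>"
  shows "\<phi> v = (\<Sum>i\<in>UNIV. v $ i *\<^sub>R \<phi> (axis i 1))"
proof -
  have "\<phi> v = \<phi> (\<Sum>i\<in>UNIV. v $ i *\<^sub>R axis i 1)"
    using basis_expansion[of v] by (simp add: scalar_mult_eq_scaleR)
  then show ?thesis by (simp add: linear_sum[OF assms] linear_cmul[OF assms])
qed

lemma tr_rank_one:
  fixes \<phi> :: "real ^ 'n \<Rightarrow> real"
  assumes "linear \<phi>"
  shows "tr (\<lambda>x. \<phi> x *\<^sub>R v) = \<phi> v"
  unfolding tr_eq_sum by (subst linear_eq_sum_axis[OF assms, of v]) (simp add: mult.commute)

lemma tr_comp_commute:
  assumes "linear f" "linear h"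
  shows "tr (\<lambda>x. f (h x)) = tr (\<lambda>x. h (f x))"
  unfolding tr_def
  using trace_mul_sym[of "matrix f" "matrix h"] matrix_compose[OF assms] matrix_compose[OF assms(2,1)]
  by (simp add: o_def)

lemma tr_adjoint:
  fixes f :: "real ^ 'n \<Rightarrow> real ^ 'n"
  assumes "linear f"
  shows "tr (adjoint f) = tr f"
  by (simp add: tr_def matrix_adjoint[OF assms] trace_def transpose_def)

text \<open>
  Traces do not depend on the basis. It is used both for the adjoint with respect to an indefinite
  metric and for the change of coordinates.
\<close>
lemma tr_conjugate:
  fixes J :: "real ^ 'n \<Rightarrow> real ^ 'n"
  assumes J: "linear J" "inj J" and f: "linear f" "linear f'" and "\<And>x. J (f x) = f' (J x)"
  shows "tr f = tr f'"
proof -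
  obtain K where K: "linear K" "K \<circ> J = id"
    using linear_injective_left_inverse[OF J] by blast
  have JK: "J \<circ> K = id"
    using linear_inverse_left[OF J(1) K(1)] K(2) by blast
  have "f = (\<lambda>x. K (f' (J x)))"
    using K(2) assms(5) by (metis comp_apply id_apply)
  then have "tr f = tr (\<lambda>x. (f' \<circ> J) (K x))"
    using tr_comp_commute[OF K(1) linear_compose[OF J(1) f(2)]] by simp
  also have "\<dots> = tr f'"
    using JK by (simp add: fun_eq_iff)
  finally show ?thesis .
qed

section \<open>Scalar products of arbitrary signature\<close>

locale metric_form =
  fixes g :: "real ^ 'n::finite \<Rightarrow> real ^ 'n \<Rightarrow> real"
  assumes bilin: "bilinear g"
    and sym: "g X Y = g Y X"
    and nondeg: "(\<And>Y. g X Y = 0) \<Longrightarrow> X = 0"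
begin

lemmas g_simps = bilinear_ladd[OF bilin] bilinear_radd[OF bilin] bilinear_lmul[OF bilin]
  bilinear_rmul[OF bilin] bilinear_lneg[OF bilin] bilinear_rneg[OF bilin]
  bilinear_lsub[OF bilin] bilinear_rsub[OF bilin] bilinear_lzero[OF bilin] bilinear_rzero[OF bilin]

lemma linear_left: "linear (\<lambda>X. g X Y)" and linear_right: "linear (\<lambda>Y. g X Y)"
  using bilin by (simp_all add: bilinear_def)

lemma eqI: "(\<And>Z. g X Z = g Y Z) \<Longrightarrow> X = Y"
  using nondeg[of "X - Y"] by (simp add: g_simps)

definition gram :: "real ^ 'n ^ 'n" where
  "gram = (\<chi> i j. g (axis j 1) (axis i 1))"

lemma gram_mult: "(gram *v w) $ i = g w (axis i 1)"
  using linear_eq_sum_axis[OF linear_left[of "axis i 1"], of w]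
  by (simp add: gram_def matrix_vector_mult_def mult.commute)

lemma inner_gram: "X \<bullet> (gram *v W) = g W X"
  using linear_eq_sum_axis[OF linear_right[of W], of X]
  by (simp add: inner_vec_def gram_mult)

lemma gram_inj: "gram *v w = 0 \<Longrightarrow> w = 0"
  using inner_gram[of _ w] by (intro nondeg) (metis inner_zero_right)

lemma det_gram: "det gram \<noteq> 0"
  using gram_inj by (simp add: invertible_det_nz[symmetric] invertible_left_inverse
      matrix_left_invertible_ker)

text \<open>
  The vector representing a functional is given by Cramer's rule rather than by mere existence:
  the formula shows that it depends smoothly on the metric and on the functional.
\<close>
lemma riesz_iff:
  assumes "linear \<phi>"
  shows "(\<forall>Z. g W Z = \<phi> Z) \<longleftrightarrow>
    W = (\<chi> k. det (\<chi> i j. if j = k then \<phi> (axis i 1) else g (axis j 1) (axis i 1)) / det gram)"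
proof -
  have "(\<forall>Z. g W Z = \<phi> Z) \<longleftrightarrow> (\<forall>i. g W (axis i 1) = \<phi> (axis i 1))"
  proof
    assume *: "\<forall>i. g W (axis i 1) = \<phi> (axis i 1)"
    show "\<forall>Z. g W Z = \<phi> Z"
    proof
      fix Z
      show "g W Z = \<phi> Z"
        by (subst linear_eq_sum_axis[OF linear_right[of W], of Z], subst linear_eq_sum_axis[OF assms, of Z])
           (simp add: *)
    qed
  qed simp
  also have "\<dots> \<longleftrightarrow> gram *v W = (\<chi> i. \<phi> (axis i 1))"
    by (simp add: vec_eq_iff gram_mult)
  also have "\<dots> \<longleftrightarrow> W = (\<chi> k. det (\<chi> i j. if j = k then \<phi> (axis i 1) else gram $ i $ j) / det gram)"
    by (subst cramer[OF det_gram]) (simp cong: if_cong)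
  finally show ?thesis by (simp add: gram_def cong: if_cong)
qed

lemma riesz_the:
  assumes "linear \<phi>"
  shows "g (THE W. \<forall>Z. g W Z = \<phi> Z) Y = \<phi> Y"
  using theI'[of "\<lambda>W. \<forall>Z. g W Z = \<phi> Z"] riesz_iff[OF assms] by auto

lemma tr_metric_adjoint:
  assumes "linear f" "linear h" "\<And>X W. g (f X) W = g X (h W)"
  shows "tr f = tr h"
proof -
  have "gram *v h W = adjoint f (gram *v W)" for W
  proof (rule vector_eq_ldot[THEN iffD1, rule_format])
    fix X
    show "X \<bullet> (gram *v h W) = X \<bullet> adjoint f (gram *v W)"
      by (simp add: adjoint_works[OF assms(1)] inner_gram assms(3) sym[of "h W" X] sym[of W "f X"])
  qed
  then have "tr h = tr (adjoint f)"
    using gram_inj assms(2) adjoint_linear[OF assms(1)]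
    by (intro tr_conjugate[of "(*v) gram"]) (auto simp: linear_injective_0)
  then show ?thesis using tr_adjoint[OF assms(1)] by simp
qed

end

section \<open>Algebraic curvature tensors\<close>

text \<open>
  The Ricci form and the raising of an index depend only on a trilinear map and a scalar product.
  Separating them from the manifold lets the same notions be used for the tangent space at a point
  and for the metric in a coordinate domain.
\<close>
definition ric :: "(real ^ 'n \<Rightarrow> real ^ 'n \<Rightarrow> real ^ 'n \<Rightarrow> real ^ 'n) \<Rightarrow>
    real ^ 'n \<Rightarrow> real ^ 'n \<Rightarrow> real" where
  "ric R Y Z = tr (\<lambda>X. R X Y Z)"

definition raise :: "(real ^ 'n \<Rightarrow> real ^ 'n \<Rightarrow> real) \<Rightarrow> (real ^ 'n \<Rightarrow> real ^ 'n \<Rightarrow> real) \<Rightarrow>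
    real ^ 'n \<Rightarrow> real ^ 'n" where
  "raise g S X = (THE W. \<forall>Y. g W Y = S X Y)"

locale curvature_form = metric_form g
  for g :: "real ^ 'n::finite \<Rightarrow> real ^ 'n \<Rightarrow> real" +
  fixes R :: "real ^ 'n \<Rightarrow> real ^ 'n \<Rightarrow> real ^ 'n \<Rightarrow> real ^ 'n"
  assumes R_linear2: "linear (\<lambda>Y. R X Y Z)" and R_linear3: "linear (\<lambda>Z. R X Y Z)"
    and R_antisym: "R X Y Z = - R Y X Z"
    and bianchi: "R X Y Z + R Y Z X + R Z X Y = 0"
    and R_skew: "g (R X Y Z) W = - g Z (R X Y W)"
begin

abbreviation S where "S \<equiv> ric R"
abbreviation Q where "Q \<equiv> raise g (ric R)"
abbreviation r where "r \<equiv> tr (raise g (ric R))"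

lemma R_linear1: "linear (\<lambda>X. R X Y Z)"
  using linear_compose_neg[OF R_linear2[of Y Z]] by (simp add: R_antisym[of Y _ Z])

lemmas R_simps = linear_add[OF R_linear1] linear_add[OF R_linear2] linear_add[OF R_linear3]
  linear_cmul[OF R_linear1] linear_cmul[OF R_linear2] linear_cmul[OF R_linear3]

text \<open>
  Adding the Bianchi identity over the four cyclic arrangements of the arguments, with signs, leaves
  only the two terms to be compared.
\<close>
lemma pair_symmetry: "g (R X Y Z) W = g (R Z W X) Y"
proof -
  define \<rho> where "\<rho> X Y Z W = g (R X Y Z) W" for X Y Z W
  have 1: "\<rho> X Y Z W = - \<rho> Y X Z W" for X Y Z W
    by (simp add: \<rho>_def R_antisym[of X Y] g_simps)
  have 2: "\<rho> X Y Z W = - \<rho> X Y W Z" for X Y Z W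
    using R_skew[of X Y Z W] by (simp add: \<rho>_def sym[of Z])
  have 3: "\<rho> X Y Z W + \<rho> Y Z X W + \<rho> Z X Y W = 0" for X Y Z W
    unfolding \<rho>_def g_simps[symmetric] by (simp add: bianchi g_simps)
  have "\<rho> X Y Z W = \<rho> Z W X Y"
    using 3[of X Y Z W] 3[of Y Z W X] 3[of Z W X Y] 3[of W X Y Z]
      2[of Y Z W X] 2[of Z W Y X] 1[of X Z W Y] 2[of Z X W Y] 2[of X Y W Z]
      1[of Y W X Z] 2[of W Y X Z] 2[of W X Y Z]
    by linarith
  then show ?thesis by (simp add: \<rho>_def)
qed

lemma S_linear_left: "linear (\<lambda>Y. S Y Z)" and S_linear_right: "linear (\<lambda>Z. S Y Z)"
  unfolding ric_def by (auto intro!: linearI simp: R_simps tr_add tr_scaleR)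

text \<open>
  By the pair symmetry, \<open>X \<mapsto> R X Y Z\<close> and \<open>X \<mapsto> R X Z Y\<close> are adjoint with respect to \<open>g\<close>.
\<close>
lemma S_sym: "S Y Z = S Z Y"
proof -
  have "g (R X Y Z) W = g X (R W Z Y)" for X W
  proof -
    have "g (R X Y Z) W = g (R Z W X) Y" by (rule pair_symmetry)
    also have "\<dots> = - g X (R Z W Y)" by (rule R_skew)
    also have "\<dots> = g X (R W Z Y)" by (simp add: R_antisym[of Z W] g_simps)
    finally show ?thesis .
  qed
  then show ?thesis
    unfolding ric_def by (intro tr_metric_adjoint R_linear1)
qed

lemma g_Q: "g (Q X) Y = S X Y"
  unfolding raise_def by (rule riesz_the[OF S_linear_right])

lemma Q_linear: "linear Q"
  by (intro linearI eqI) (simp_all add: g_simps g_Q linear_add[OF S_linear_left]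
      linear_cmul[OF S_linear_left])

lemmas SQ_simps = linear_add[OF S_linear_left] linear_add[OF S_linear_right]
  linear_cmul[OF S_linear_left] linear_cmul[OF S_linear_right]
  linear_diff[OF S_linear_left] linear_diff[OF S_linear_right]
  linear_neg[OF S_linear_left] linear_neg[OF S_linear_right]
  linear_0[OF S_linear_left] linear_0[OF S_linear_right]
  linear_add[OF Q_linear] linear_cmul[OF Q_linear] linear_diff[OF Q_linear] linear_neg[OF Q_linear]

definition T :: "(nat \<Rightarrow> real) \<Rightarrow> real ^ 'n \<Rightarrow> real ^ 'n \<Rightarrow> real ^ 'n \<Rightarrow> real ^ 'n" where
  "T a X Y Z = a 0 *\<^sub>R R X Y Z
   + (a 1 * S Y Z) *\<^sub>R X + (a 2 * S X Z) *\<^sub>R Y + (a 3 * S X Y) *\<^sub>R Z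
   + (a 4 * g Y Z) *\<^sub>R Q X + (a 5 * g X Z) *\<^sub>R Q Y + (a 6 * g X Y) *\<^sub>R Q Z
   + (a 7 * r) *\<^sub>R (g Y Z *\<^sub>R X - g X Z *\<^sub>R Y)"

lemma T_linear1: "linear (\<lambda>X. T a X Y Z)"
  and T_linear2: "linear (\<lambda>Y. T a X Y Z)"
  and T_linear3: "linear (\<lambda>Z. T a X Y Z)"
  unfolding T_def by (auto intro!: linearI simp: R_simps g_simps SQ_simps algebra_simps)

lemmas T_simps =
  linear_add[OF T_linear1] linear_add[OF T_linear2] linear_add[OF T_linear3]
  linear_diff[OF T_linear1] linear_diff[OF T_linear2] linear_diff[OF T_linear3]
  linear_cmul[OF T_linear1] linear_cmul[OF T_linear2] linear_cmul[OF T_linear3]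
  linear_neg[OF T_linear1] linear_neg[OF T_linear2] linear_neg[OF T_linear3]
  linear_0[OF T_linear1] linear_0[OF T_linear2] linear_0[OF T_linear3]

subsection \<open>Contraction of the second and third arguments\<close>

text \<open>
  Contracting two arguments of a tensor needs a metric. Here the contraction over \<open>Y\<close> and \<open>Z\<close> of
  \<open>g (T a X Y Z) W\<close> is expressed as the ordinary trace of the endomorphism that corresponds to this
  bilinear form in \<open>Y\<close> and \<open>Z\<close>; it works for every signature and without a choice of frame.
\<close>
definition contracted where
  "contracted a X W Y = a 0 *\<^sub>R R Y X W
   + (a 1 * g X W) *\<^sub>R Q Y + (a 2 * g Y W) *\<^sub>R Q X + (a 3 * S X Y) *\<^sub>R W
   + (a 4 * S X W) *\<^sub>R Y + (a 5 * S Y W) *\<^sub>R X + (a 6 * g X Y) *\<^sub>R Q W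
   + (a 7 * r) *\<^sub>R (g X W *\<^sub>R Y - g Y W *\<^sub>R X)"

lemma g_contracted: "g (contracted a X W Y) Z = g (T a X Y Z) W"
proof -
  have "g (R Y X W) Z = g (R X Y Z) W"
    using R_skew[of Y X W Z] by (simp add: R_antisym[of X Y Z] sym[of W "R Y X Z"] g_simps)
  then show ?thesis
    by (simp add: contracted_def T_def g_simps g_Q sym[of W Z] S_sym[of W Z] algebra_simps)
qed

lemma contracted_linear: "linear (contracted a X W)"
  unfolding contracted_def by (auto intro!: linearI simp: R_simps g_simps SQ_simps algebra_simps)

text \<open>
  Every term of \<open>contracted\<close> is a multiple of the identity, of \<open>Q\<close>, of a rank one map, or of the
  map that defines the Ricci form. This is where the coefficient that separates the two cases of the
  theorem comes from.
\<close>
lemma tr_contracted: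
  "tr (contracted a X W) =
     (a 0 + a 2 + a 3 + real CARD('n) * a 4 + a 5 + a 6) * S X W
   + (a 1 + a 7 * (real CARD('n) - 1)) * r * g X W"
proof -
  have lin: "linear (\<lambda>Y. c * g Y W)" "linear (\<lambda>Y. c * g X Y)"
    "linear (\<lambda>Y. c * S X Y)" "linear (\<lambda>Y. c * S Y W)" for c
    by (auto intro!: linearI simp: g_simps SQ_simps algebra_simps)
  have r1: "tr (\<lambda>Y. g Y W *\<^sub>R X) = g X W"
    by (rule tr_rank_one[OF linear_left])
  show ?thesis
    unfolding contracted_def tr_add tr_diff tr_scaleR tr_ident tr_rank_one[OF lin(1)]
      tr_rank_one[OF lin(2)] tr_rank_one[OF lin(3)] tr_rank_one[OF lin(4)] r1
      ric_def[of R X W, symmetric] g_Q sym[of X "Q W"] S_sym[of W X]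
    by (simp add: algebra_simps)
qed

text \<open>
  A skew map that kills \<open>T a\<close> also kills its contraction: the term in which \<open>F\<close> acts on the two
  contracted arguments is a commutator, hence has trace zero. The multiple of \<open>g\<close> in the contraction
  is killed by every skew map, so only the multiple of \<open>S\<close> remains.
\<close>
lemma contraction_invariant:
  assumes F: "linear F" and skew: "\<And>X Y. g (F X) Y = - g X (F Y)"
    and inv: "\<And>U V W. endo_act F (T a) U V W = 0"
  shows "(a 0 + a 2 + a 3 + real CARD('n) * a 4 + a 5 + a 6) * (S (F X) W + S X (F W)) = 0"
proof -
  have "contracted a X (F W) Y + contracted a (F X) W Y + contracted a X W (F Y)
      = F (contracted a X W Y)" for Y
  proof (rule eqI)
    fix Z
    have "g (endo_act F (T a) X Y Z) W = 0" by (simp add: inv g_simps)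
    then show "g (contracted a X (F W) Y + contracted a (F X) W Y + contracted a X W (F Y)) Z
      = g (F (contracted a X W Y)) Z"
      by (simp add: endo_act_def g_simps skew g_contracted)
  qed
  then have "tr (\<lambda>Y. F (contracted a X W Y)) = tr (contracted a X (F W)) + tr (contracted a (F X) W)
      + tr (\<lambda>Y. contracted a X W (F Y))"
    by (simp add: tr_add[symmetric])
  then have "tr (contracted a X (F W)) + tr (contracted a (F X) W) = 0"
    using tr_comp_commute[OF F contracted_linear, of a X W] by linarith
  then show ?thesis
    by (simp add: tr_contracted skew algebra_simps)
qed

text \<open>
  The maps that kill a tensor form a Lie algebra.
\<close>
lemma endo_act_commutator:
  assumes F: "linear F" "\<And>U V W. endo_act F (T a) U V W = 0"
    and G: "linear G" "\<And>U V W. endo_act G (T a) U V W = 0"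
  shows "endo_act (\<lambda>v. F (G v) - G (F v)) (T a) U V W = 0"
proof -
  have f: "F (T a U V W) = T a (F U) V W + T a U (F V) W + T a U V (F W)" for U V W
    using F(2)[of U V W] by (simp add: endo_act_def algebra_simps)
  have g: "G (T a U V W) = T a (G U) V W + T a U (G V) W + T a U V (G W)" for U V W
    using G(2)[of U V W] by (simp add: endo_act_def algebra_simps)
  show ?thesis
    by (simp add: endo_act_def f g T_simps linear_add[OF F(1)] linear_add[OF G(1)])
qed

end

section \<open>A unit vector in the nullity distribution\<close>

locale nullity_form = curvature_form g R
  for g :: "real ^ 'n::finite \<Rightarrow> real ^ 'n \<Rightarrow> real"
    and R :: "real ^ 'n \<Rightarrow> real ^ 'n \<Rightarrow> real ^ 'n \<Rightarrow> real ^ 'n" +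
  fixes \<xi> :: "real ^ 'n" and k \<epsilon> :: real
  assumes eps: "\<epsilon> \<in> {1, -1}" and g_xi_xi: "g \<xi> \<xi> = \<epsilon>"
    and R_xi3: "R X Y \<xi> = k *\<^sub>R (g Y \<xi> *\<^sub>R X - g X \<xi> *\<^sub>R Y)"
begin

text \<open>The eigenvalue of the Ricci operator on \<open>\<xi>\<close>.\<close>
definition \<kappa> :: real where "\<kappa> = k * (real CARD('n) - 1)"

lemma eps_sq: "\<epsilon> * \<epsilon> = 1" and eps_sq': "\<epsilon> * (\<epsilon> * x) = x"
  using eps by auto

lemma eps_neq: "\<epsilon> \<noteq> 0"
  using eps by auto

lemma sym_xi: "NO_MATCH \<xi> Y \<Longrightarrow> g \<xi> Y = g Y \<xi>"
  by (rule sym)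

text \<open>
  The nullity condition concerns the third argument; the pair symmetry moves it to the first, so
  that the curvature operators \<open>R \<xi> X\<close> are the multiples by \<open>k\<close> of the rotations \<open>\<xi> \<and> X\<close>.
\<close>
lemma R_xi1: "R \<xi> X Y = k *\<^sub>R wedge g \<xi> X Y"
proof (rule eqI)
  fix Z
  have "g (R \<xi> X Y) Z = g (R Y Z \<xi>) X" by (rule pair_symmetry)
  then show "g (R \<xi> X Y) Z = g (k *\<^sub>R wedge g \<xi> X Y) Z"
    by (simp add: R_xi3 wedge_def g_simps sym[of Y X] sym[of Z \<xi>] sym[of Y \<xi>] sym[of Z X])
qed

lemma S_xi: "S Y \<xi> = \<kappa> * g Y \<xi>"
  unfolding ric_def R_xi3 tr_scaleR tr_diff tr_ident tr_rank_one[OF linear_left] \<kappa>_def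
  by (simp add: algebra_simps)

lemma S_xi': "S \<xi> Y = \<kappa> * g Y \<xi>"
  using S_xi S_sym by metis

lemma Q_xi: "Q \<xi> = \<kappa> *\<^sub>R \<xi>"
  by (rule eqI) (simp add: g_Q S_xi' g_simps sym_xi)

lemma wedge_linear: "linear (wedge g Z X)"
  unfolding wedge_def by (auto intro!: linearI simp: g_simps algebra_simps)

lemma wedge_skew: "g (wedge g Z X U) V = - g U (wedge g Z X V)"
  by (simp add: wedge_def g_simps sym[of U])

text \<open>
  With \<open>\<xi>\<close> as first argument of the curvature operator, both sides of the pseudosymmetry
  condition are multiples of the same tensor, by \<open>k\<close> and by \<open>L\<close>. Unless these agree, the tensor
  vanishes. All the rest is drawn from this invariance.
\<close>
lemma xi_wedge_invariant:
  assumes pseudo: "\<And>U V W Z X.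
      endo_act (R Z X) (T a) U V W = L *\<^sub>R endo_act (wedge g Z X) (T a) U V W"
    and L: "L \<noteq> k"
  shows "endo_act (wedge g \<xi> X) (T a) U V W = 0"
proof -
  have "R \<xi> X = (\<lambda>Y. k *\<^sub>R wedge g \<xi> X Y)" by (simp add: fun_eq_iff R_xi1)
  then have "endo_act (R \<xi> X) (T a) U V W = k *\<^sub>R endo_act (wedge g \<xi> X) (T a) U V W"
    by (simp add: endo_act_def T_simps algebra_simps)
  with pseudo have "k *\<^sub>R endo_act (wedge g \<xi> X) (T a) U V W
      = L *\<^sub>R endo_act (wedge g \<xi> X) (T a) U V W"
    by metis
  with L show ?thesis by (metis scaleR_cancel_right)
qed

lemma wedge_xi_xi: "g X \<xi> = 0 \<Longrightarrow> wedge g \<xi> X \<xi> = - \<epsilon> *\<^sub>R X"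
  by (simp add: wedge_def g_xi_xi)

lemma wedge_xi_orth: "g Z \<xi> = 0 \<Longrightarrow> wedge g \<xi> X Z = g X Z *\<^sub>R \<xi>"
  by (simp add: wedge_def sym_xi)

text \<open>
  The contraction makes the Ricci form invariant under all \<open>\<xi> \<and> X\<close>. These maps rotate \<open>\<xi>\<close> into
  any other direction, so the value \<open>\<kappa>\<close> known on \<open>\<xi>\<close> spreads to all vectors.
\<close>
lemma einstein_from_contraction:
  assumes inv: "\<And>X U V W. endo_act (wedge g \<xi> X) (T a) U V W = 0"
    and c: "a 0 + a 2 + a 3 + real CARD('n) * a 4 + a 5 + a 6 \<noteq> 0"
  shows "S X Y = r / real CARD('n) * g X Y"
proof -
  have S: "S U X = \<kappa> * g U X" for U X
  proof -
    have "S (wedge g \<xi> X U) \<xi> + S U (wedge g \<xi> X \<xi>) = 0"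
      using contraction_invariant[OF wedge_linear wedge_skew inv] c by simp
    then have "\<epsilon> * (\<kappa> * g U X - S U X) = 0"
      by (simp add: wedge_def SQ_simps S_xi S_xi' g_simps g_xi_xi sym_xi sym[of X U] algebra_simps)
    then show ?thesis using eps_neq by simp
  qed
  have "Q = (\<lambda>U. \<kappa> *\<^sub>R U)"
    by (intro ext eqI) (simp add: g_Q S g_simps)
  then have "r = \<kappa> * real CARD('n)"
    using tr_scaleR[of \<kappa> "\<lambda>x. x"] by (simp add: tr_ident)
  then show ?thesis by (simp add: S)
qed

lemma T_xi_xi:
  "T a Z \<xi> \<xi> = (\<epsilon> * (a 0 * k + a 1 * \<kappa> + a 7 * r)) *\<^sub>R Z + (\<epsilon> * a 4) *\<^sub>R Q Z
     + (((a 2 + a 3 + a 5 + a 6) * \<kappa> - a 0 * k - a 7 * r) * g Z \<xi>) *\<^sub>R \<xi>"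
  by (simp add: T_def R_xi3 S_xi g_xi_xi Q_xi algebra_simps)

lemma g_T_xi:
  "g (T a U V W) \<xi> =
     (a 0 * k + a 7 * r) * (g V W * g U \<xi> - g U W * g V \<xi>)
   + a 1 * S V W * g U \<xi> + a 2 * S U W * g V \<xi> + a 3 * S U V * g W \<xi>
   + \<kappa> * (a 4 * g V W * g U \<xi> + a 5 * g U W * g V \<xi> + a 6 * g U V * g W \<xi>)"
proof -
  have gR: "g (R U V W) \<xi> = k * (g V W * g U \<xi> - g U W * g V \<xi>)"
    unfolding R_skew R_xi3 by (simp add: g_simps sym[of W] algebra_simps)
  show ?thesis unfolding T_def g_simps g_Q S_xi gR by (simp add: algebra_simps)
qed

text \<open>
  The invariance is evaluated at \<open>(Z, \<xi>, \<xi>)\<close> and paired with \<open>\<xi>\<close>. The rotation replaces one of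
  these three occurrences of \<open>\<xi>\<close> by \<open>X\<close>. The Ricci form of \<open>Z\<close> and \<open>X\<close> then comes from the term
  of \<open>T a\<close> in which \<open>S\<close> pairs the first slot with the slot concerned, and the coefficients of these
  terms are \<open>a 2\<close>, \<open>a 3\<close> and \<open>a 4\<close>.
\<close>
lemma first_slot:
  assumes inv: "\<And>X U V W. endo_act (wedge g \<xi> X) (T a) U V W = 0"
    and X: "g X \<xi> = 0" and Z: "g Z \<xi> = 0"
  shows "(a 2 + a 3 + a 4) * (S Z X - \<kappa> * g Z X) = 0"
proof -
  have "g (endo_act (wedge g \<xi> X) (T a) Z \<xi> \<xi>) \<xi> = 0" by (simp add: inv g_simps)
  then have "\<epsilon> * g (T a Z \<xi> \<xi>) X - g X Z * g (T a \<xi> \<xi> \<xi>) \<xi>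
      + \<epsilon> * (g (T a Z X \<xi>) \<xi> + g (T a Z \<xi> X) \<xi>) = 0"
    by (simp add: endo_act_def wedge_skew wedge_xi_xi[OF X] wedge_xi_orth[OF Z] T_simps g_simps
        algebra_simps)
  then have "\<epsilon> * ((a 2 + a 3 + a 4) * (S Z X - \<kappa> * g Z X)) = 0"
    by (simp add: T_xi_xi g_T_xi g_simps X Z g_Q S_xi S_xi' g_xi_xi sym[of X Z] sym_xi
        eps_sq eps_sq' algebra_simps)
  with eps_neq show ?thesis by simp
qed

text \<open>
  The commutator of \<open>\<xi> \<and> X\<close> and \<open>\<xi> \<and> Y\<close> is a multiple of \<open>X \<and> Y\<close>, which therefore also kills
  \<open>T a\<close>. As it annihilates \<open>\<xi>\<close>, it commutes with the endomorphism \<open>U \<mapsto> T a U \<xi> \<xi>\<close>, which is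
  \<open>a 4\<close> times the Ricci operator up to a sign, a multiple of the identity, and a map into the line
  of \<open>\<xi>\<close>.
\<close>
lemma wedge_commutes_Q:
  assumes inv: "\<And>X U V W. endo_act (wedge g \<xi> X) (T a) U V W = 0"
    and a4: "a 4 \<noteq> 0" and X: "g X \<xi> = 0" and Y: "g Y \<xi> = 0"
  shows "wedge g X Y (Q U) = Q (wedge g X Y U)"
proof -
  define G where "G = (\<lambda>v. wedge g \<xi> X (wedge g \<xi> Y v) - wedge g \<xi> Y (wedge g \<xi> X v))"
  have G: "G v = - \<epsilon> *\<^sub>R wedge g X Y v" for v
    by (simp add: G_def wedge_def g_simps g_xi_xi X Y sym[of \<xi> X] sym[of \<xi> Y] sym[of X Y]
        algebra_simps)
  have G0: "G \<xi> = 0" by (simp add: G wedge_def X Y)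
  have "endo_act G (T a) U \<xi> \<xi> = 0"
    unfolding G_def by (intro endo_act_commutator wedge_linear inv)
  then have "G (T a U \<xi> \<xi>) = T a (G U) \<xi> \<xi>"
    by (simp add: endo_act_def G0 T_simps)
  moreover have "g (G U) \<xi> = 0"
    by (simp add: G wedge_def g_simps X Y)
  moreover have "linear (\<lambda>v. (- \<epsilon>) *\<^sub>R wedge g X Y v)"
    by (intro linear_compose_scale_right wedge_linear)
  then have "linear G" by (simp only: G[symmetric])
  ultimately have "(\<epsilon> * a 4) *\<^sub>R G (Q U) = (\<epsilon> * a 4) *\<^sub>R Q (G U)"
    using G0 by (simp add: T_xi_xi linear_add linear_cmul)
  then have "G (Q U) = Q (G U)" using a4 eps_neq by simp
  then show ?thesis using eps_neq by (simp add: G SQ_simps)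
qed

lemma eta_einstein_if_scalar_on_orthogonal:
  assumes "\<And>X Y. g X \<xi> = 0 \<Longrightarrow> g Y \<xi> = 0 \<Longrightarrow> S X Y = \<mu> * g X Y"
  shows "S X Y = \<mu> * g X Y + \<epsilon> * (\<kappa> - \<mu>) * (\<epsilon> * g X \<xi> * (\<epsilon> * g Y \<xi>))"
proof -
  define P where "P X = X - (\<epsilon> * g X \<xi>) *\<^sub>R \<xi>" for X
  have "g (P X) \<xi> = 0" for X
    by (simp add: P_def g_simps g_xi_xi eps_sq eps_sq' algebra_simps)
  then have "S (P X) (P Y) = \<mu> * g (P X) (P Y)" using assms by blast
  then show ?thesis
    by (simp add: P_def g_simps SQ_simps S_xi S_xi' g_xi_xi sym_xi eps_sq eps_sq' algebra_simps)
qed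

text \<open>
  Taking the trace identifies the factor on the orthogonal complement of \<open>\<xi>\<close> as a function of the
  scalar curvature, which is what makes it smooth on the manifold.
\<close>
lemma eta_einstein_scalar:
  assumes "\<And>X Y. g X \<xi> = 0 \<Longrightarrow> g Y \<xi> = 0 \<Longrightarrow> S X Y = \<mu> * g X Y"
  defines "\<alpha> \<equiv> (r - \<kappa>) / (real CARD('n) - 1)"
  shows "S X Y = \<alpha> * g X Y + \<epsilon> * (\<kappa> - \<alpha>) * (\<epsilon> * g X \<xi> * (\<epsilon> * g Y \<xi>))"
proof -
  note S = eta_einstein_if_scalar_on_orthogonal[of \<mu>, OF assms(1)]
  have "Q X = \<mu> *\<^sub>R X + g X \<xi> *\<^sub>R ((\<epsilon> * (\<kappa> - \<mu>)) *\<^sub>R \<xi>)" for X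
    by (rule eqI) (simp add: g_Q S g_simps sym_xi eps_sq eps_sq' algebra_simps)
  then have "r = tr (\<lambda>X. \<mu> *\<^sub>R X + g X \<xi> *\<^sub>R ((\<epsilon> * (\<kappa> - \<mu>)) *\<^sub>R \<xi>))"
    by presburger
  also have "\<dots> = \<mu> * real CARD('n) + \<epsilon> * (\<kappa> - \<mu>) * \<epsilon>"
    unfolding tr_add tr_scaleR tr_ident tr_rank_one[OF linear_left] by (simp add: g_simps g_xi_xi)
  finally have r: "r - \<kappa> = \<mu> * (real CARD('n) - 1)"
    by (simp add: eps_sq eps_sq' algebra_simps)
  show ?thesis
    \<comment> \<open>In dimension one \<open>\<alpha>\<close> is 0, a quotient by 0, and it may differ from \<open>\<mu>\<close>; but then the
        orthogonal complement is trivial and any factor will do.\<close>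
  proof (cases "CARD('n) = 1")
    case False
    then have "\<alpha> = \<mu>" by (simp add: \<alpha>_def r)
    show ?thesis unfolding \<open>\<alpha> = \<mu>\<close> by (rule S)
  next
    case True
    then obtain i :: 'n where i: "UNIV = {i}" using card_1_singletonE by blast
    then have all: "j = i" for j by blast
    have "\<xi> \<noteq> 0" using g_xi_xi eps_neq by (auto simp: g_simps)
    then have "\<xi> $ i \<noteq> 0" using all by (metis vec_eq_iff zero_index)
    then have "X = (X $ i / \<xi> $ i) *\<^sub>R \<xi>" for X
      by (simp add: vec_eq_iff) (metis all nonzero_eq_divide_eq)
    then have orth: "X = 0" if "g X \<xi> = 0" for X
    proof -
      obtain c where "X = c *\<^sub>R \<xi>" using \<open>\<And>X. X = (X $ i / \<xi> $ i) *\<^sub>R \<xi>\<close> by blast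
      with that show ?thesis using eps_neq by (simp add: g_simps g_xi_xi)
    qed
    show ?thesis
      by (rule eta_einstein_if_scalar_on_orthogonal) (auto dest!: orth simp: SQ_simps g_simps)
  qed
qed

text \<open>
  A symmetric operator that commutes with all rotations of the complement of \<open>\<xi>\<close> is scalar there.
  Testing with a single non-null \<open>Y\<close> in the complement suffices: its vectors orthogonal to \<open>Y\<close> are
  eigenvectors with the eigenvalue of \<open>Y\<close>. If no such \<open>Y\<close> exists, polarization and nondegeneracy
  make the complement trivial.
\<close>
lemma ricci_scalar_on_orthogonal:
  assumes inv: "\<And>X U V W. endo_act (wedge g \<xi> X) (T a) U V W = 0"
    and a4: "a 4 \<noteq> 0"
  shows "\<exists>\<mu>. \<forall>X Y. g X \<xi> = 0 \<longrightarrow> g Y \<xi> = 0 \<longrightarrow> S X Y = \<mu> * g X Y"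
proof (cases "\<exists>Y. g Y \<xi> = 0 \<and> g Y Y \<noteq> 0")
  case True
  then obtain Y where Y: "g Y \<xi> = 0" "g Y Y \<noteq> 0" by blast
  define \<mu> where "\<mu> = S Y Y / g Y Y"
  have comm: "S Y U * g X Z - S X U * g Y Z = g Y U * S X Z - g X U * S Y Z"
    if "g X \<xi> = 0" for X U Z
  proof -
    have "g (wedge g X Y (Q U)) Z = g (Q (wedge g X Y U)) Z"
      using wedge_commutes_Q[OF inv a4 that Y(1)] by simp
    then show ?thesis
      by (simp add: wedge_def g_simps g_Q SQ_simps sym[of _ "Q U"] S_sym[of U])
  qed
  have orth: "S X Z = \<mu> * g X Z" if X: "g X \<xi> = 0" "g X Y = 0" for X Z
  proof -
    have "S X Y = 0"
      using comm[OF X(1), of Y Y] X(2) Y(2) S_sym[of X Y] by (simp add: algebra_simps)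
    then show ?thesis
      using comm[OF X(1), of Y Z] X(2) Y(2) by (simp add: \<mu>_def field_simps)
  qed
  have "S X Z = \<mu> * g X Z" if "g X \<xi> = 0" "g Z \<xi> = 0" for X Z
  proof -
    define X' where "X' = X - (g X Y / g Y Y) *\<^sub>R Y"
    define Z' where "Z' = Z - (g Z Y / g Y Y) *\<^sub>R Y"
    have X': "S X' V = \<mu> * g X' V" for V
      by (rule orth) (use that Y in \<open>simp_all add: X'_def g_simps\<close>)
    have Z': "S Z' V = \<mu> * g Z' V" for V
      by (rule orth) (use that Y in \<open>simp_all add: Z'_def g_simps\<close>)
    have YY: "S Y Y = \<mu> * g Y Y" using Y by (simp add: \<mu>_def)
    have "S Y Z' = \<mu> * g Y Z'" using Z'[of Y] by (metis S_sym sym)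
    moreover have "S Y Z = S Y Z' + (g Z Y / g Y Y) * S Y Y"
      and "g Y Z = g Y Z' + (g Z Y / g Y Y) * g Y Y"
      by (simp_all add: Z'_def SQ_simps g_simps)
    ultimately have YZ: "S Y Z = \<mu> * g Y Z"
      using YY by (simp only:) (simp only: algebra_simps)
    have "S X Z = S X' Z + (g X Y / g Y Y) * S Y Z"
      and "g X Z = g X' Z + (g X Y / g Y Y) * g Y Z"
      by (simp_all add: X'_def SQ_simps g_simps)
    then show ?thesis
      using X'[of Z] YZ by (simp only:) (simp only: algebra_simps)
  qed
  then show ?thesis by blast
next
  case False
  have orth: "X = 0" if X: "g X \<xi> = 0" for X
  proof (rule nondeg)
    fix W
    define Z where "Z = W - (\<epsilon> * g W \<xi>) *\<^sub>R \<xi>"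
    have Z: "g Z \<xi> = 0" by (simp add: Z_def g_simps g_xi_xi eps_sq eps_sq' algebra_simps)
    have "g (X + Z) (X + Z) = 0" "g X X = 0" "g Z Z = 0"
      using False X Z by (metis g_simps(1) add_0)+
    then have "g X Z = 0" by (simp add: g_simps sym[of Z X])
    then show "g X W = 0" by (simp add: Z_def g_simps X)
  qed
  show ?thesis
    by (intro exI[of _ 0] allI impI) (auto dest!: orth simp: SQ_simps g_simps)
qed

lemma eta_einstein:
  assumes inv: "\<And>X U V W. endo_act (wedge g \<xi> X) (T a) U V W = 0"
    and a056: "a 0 + a 5 + a 6 \<noteq> 0"
    and c: "a 0 + a 2 + a 3 + real CARD('n) * a 4 + a 5 + a 6 = 0"
  defines "\<alpha> \<equiv> (r - \<kappa>) / (real CARD('n) - 1)"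
  shows "S X Y = \<alpha> * g X Y + \<epsilon> * (\<kappa> - \<alpha>) * (\<epsilon> * g X \<xi> * (\<epsilon> * g Y \<xi>))"
proof -
  have "\<exists>\<mu>. \<forall>X Y. g X \<xi> = 0 \<longrightarrow> g Y \<xi> = 0 \<longrightarrow> S X Y = \<mu> * g X Y"
  proof (cases "a 2 + a 3 + a 4 = 0")
    case False
    then show ?thesis using first_slot[OF inv] by (intro exI[of _ \<kappa>]) simp
  next
    case True
    then have "a 0 + a 5 + a 6 = - (real CARD('n) - 1) * a 4"
      using c by (simp add: algebra_simps)
    with a056 have "a 4 \<noteq> 0" by auto
    then show ?thesis using ricci_scalar_on_orthogonal[OF inv] by blast
  qed
  then show ?thesis unfolding \<alpha>_def using eta_einstein_scalar by blast
qed

end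

section \<open>Metrics on open subsets of Euclidean space\<close>

lemma bilinear_eq_sum_axis:
  fixes B :: "real ^ 'n \<Rightarrow> real ^ 'n \<Rightarrow> 'b::real_vector"
  assumes "bilinear B"
  shows "B u v = (\<Sum>i\<in>UNIV. \<Sum>j\<in>UNIV. (u $ i * v $ j) *\<^sub>R B (axis i 1) (axis j 1))"
proof -
  have l: "linear (\<lambda>u. B u v)" "linear (\<lambda>v. B u v)" for u v
    using assms by (simp_all add: bilinear_def)
  have "B u v = (\<Sum>i\<in>UNIV. u $ i *\<^sub>R B (axis i 1) v)"
    by (rule linear_eq_sum_axis[OF l(1)])
  also have "\<dots> = (\<Sum>i\<in>UNIV. u $ i *\<^sub>R (\<Sum>j\<in>UNIV. v $ j *\<^sub>R B (axis i 1) (axis j 1)))"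
    by (intro sum.cong refl arg_cong2[where f = scaleR] linear_eq_sum_axis[OF l(2)])
  finally show ?thesis by (simp add: scaleR_sum_right)
qed

text \<open>
  The product rule for a bilinear map that itself varies with the point. The point enters through a
  map \<open>h\<close>, so that it covers both a metric in its own coordinates (\<open>h\<close> the identity) and its
  pull-back along a change of coordinates.
\<close>
lemma bilinear_field_has_derivative:
  fixes B :: "'a::real_normed_vector \<Rightarrow> real ^ 'n \<Rightarrow> real ^ 'n \<Rightarrow> 'b::real_normed_vector"
    and h :: "'c::real_normed_vector \<Rightarrow> 'a"
  assumes D: "open D" and bil: "\<And>x. x \<in> D \<Longrightarrow> bilinear (B x)"
    and diff: "\<And>x u v. x \<in> D \<Longrightarrow> (\<lambda>x. B x u v) differentiable (at x)"
    and N: "open N" "y \<in> N" "h ` N \<subseteq> D"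
    and h: "(h has_derivative h') (at y)"
    and a: "(a has_derivative a') (at y)" and b: "(b has_derivative b') (at y)"
  shows "((\<lambda>y. B (h y) (a y) (b y)) has_derivative
    (\<lambda>w. frechet_derivative (\<lambda>x. B x (a y) (b y)) (at (h y)) (h' w)
        + B (h y) (a' w) (b y) + B (h y) (a y) (b' w))) (at y)"
proof -
  let ?e = "\<lambda>i. axis i (1::real) :: real ^ 'n"
  let ?dB = "\<lambda>i j. frechet_derivative (\<lambda>x. B x (?e i) (?e j)) (at (h y))"
  have hy: "h y \<in> D" using N by blast
  have dB: "((\<lambda>x. B x u v) has_derivative frechet_derivative (\<lambda>x. B x u v) (at (h y))) (at (h y))"
    for u v using diff[OF hy] by (simp add: frechet_derivative_works)
  have expand: "frechet_derivative (\<lambda>x. B x u v) (at (h y)) w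
      = (\<Sum>i\<in>UNIV. \<Sum>j\<in>UNIV. (u $ i * v $ j) *\<^sub>R ?dB i j w)" for u v w
  proof -
    have "((\<lambda>x. \<Sum>i\<in>UNIV. \<Sum>j\<in>UNIV. (u $ i * v $ j) *\<^sub>R B x (?e i) (?e j)) has_derivative
        (\<lambda>w. \<Sum>i\<in>UNIV. \<Sum>j\<in>UNIV. (u $ i * v $ j) *\<^sub>R ?dB i j w)) (at (h y))"
      by (intro has_derivative_sum has_derivative_scaleR_right dB)
    then have "((\<lambda>x. B x u v) has_derivative
        (\<lambda>w. \<Sum>i\<in>UNIV. \<Sum>j\<in>UNIV. (u $ i * v $ j) *\<^sub>R ?dB i j w)) (at (h y))"
      by (rule has_derivative_transform_within_open[OF _ D hy])
         (rule bilinear_eq_sum_axis[OF bil, symmetric])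
    from fun_cong[OF frechet_derivative_at[OF this, symmetric]] show ?thesis .
  qed
  have dBh: "((\<lambda>y. B (h y) u v) has_derivative (\<lambda>w. frechet_derivative (\<lambda>x. B x u v) (at (h y)) (h' w)))
      (at y)" for u v
    using diff_chain_at[OF h dB] by (simp add: o_def)
  have "((\<lambda>y. \<Sum>i\<in>UNIV. \<Sum>j\<in>UNIV. (a y $ i * b y $ j) *\<^sub>R B (h y) (?e i) (?e j)) has_derivative
      (\<lambda>w. \<Sum>i\<in>UNIV. \<Sum>j\<in>UNIV. (a y $ i * b y $ j) *\<^sub>R ?dB i j (h' w)
        + (a y $ i * b' w $ j + a' w $ i * b y $ j) *\<^sub>R B (h y) (?e i) (?e j))) (at y)"
    by (intro has_derivative_sum has_derivative_scaleR has_derivative_mult dBh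
        bounded_linear.has_derivative[OF bounded_linear_vec_nth] a b)
  then have "((\<lambda>y. B (h y) (a y) (b y)) has_derivative
      (\<lambda>w. \<Sum>i\<in>UNIV. \<Sum>j\<in>UNIV. (a y $ i * b y $ j) *\<^sub>R ?dB i j (h' w)
        + (a y $ i * b' w $ j + a' w $ i * b y $ j) *\<^sub>R B (h y) (?e i) (?e j))) (at y)"
    by (rule has_derivative_transform_within_open[OF _ N(1,2)])
       (use N(3) in \<open>auto intro!: bilinear_eq_sum_axis[OF bil, symmetric]\<close>)
  moreover have "(\<Sum>i\<in>UNIV. \<Sum>j\<in>UNIV. (a y $ i * b y $ j) *\<^sub>R ?dB i j (h' w)
        + (a y $ i * b' w $ j + a' w $ i * b y $ j) *\<^sub>R B (h y) (?e i) (?e j))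
      = frechet_derivative (\<lambda>x. B x (a y) (b y)) (at (h y)) (h' w)
        + B (h y) (a' w) (b y) + B (h y) (a y) (b' w)" for w
    unfolding expand[of "a y"] bilinear_eq_sum_axis[OF bil[OF hy], of "a' w"]
      bilinear_eq_sum_axis[OF bil[OF hy], of "a y"]
    by (simp add: sum.distrib scaleR_add_left)
  ultimately show ?thesis by simp
qed

lemma bilinear_field_derivative_bilinear:
  fixes B :: "'a::real_normed_vector \<Rightarrow> real ^ 'n \<Rightarrow> real ^ 'n \<Rightarrow> 'b::real_normed_vector"
  assumes D: "open D" and x: "x \<in> D" and bil: "\<And>x. x \<in> D \<Longrightarrow> bilinear (B x)"
    and diff: "\<And>x u v. x \<in> D \<Longrightarrow> (\<lambda>x. B x u v) differentiable (at x)"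
  shows "bilinear (\<lambda>u v. frechet_derivative (\<lambda>x. B x u v) (at x) w)"
proof -
  have dB: "((\<lambda>x. B x u v) has_derivative frechet_derivative (\<lambda>x. B x u v) (at x)) (at x)"
    for u v using diff[OF x] by (simp add: frechet_derivative_works)
  have lin: "frechet_derivative f (at x) w = f' w"
    if "(F has_derivative f') (at x)" "\<And>x. x \<in> D \<Longrightarrow> F x = f x" for f F f' :: "'a \<Rightarrow> 'b"
    using fun_cong[OF frechet_derivative_at[OF
          has_derivative_transform_within_open[OF that(1) D x that(2)], symmetric]] .
  show ?thesis
    unfolding bilinear_def
    by (intro conjI allI linearI lin[OF has_derivative_add[OF dB dB]]
        lin[OF has_derivative_scaleR_right[OF dB]])
       (simp_all add: bilinear_ladd[OF bil] bilinear_radd[OF bil] bilinear_lmul[OF bil]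
         bilinear_rmul[OF bil])
qed

lemma smooth_on_bilinear_field:
  fixes B :: "'a::real_normed_vector \<Rightarrow> real ^ 'n \<Rightarrow> real ^ 'n \<Rightarrow> 'b::real_normed_vector"
  assumes D: "open D" and bil: "\<And>x. x \<in> D \<Longrightarrow> bilinear (B x)"
    and B: "\<And>u v. smooth_on D (\<lambda>x. B x u v)" and a: "smooth_on D a" and b: "smooth_on D b"
  shows "smooth_on D (\<lambda>x. B x (a x) (b x))"
proof (rule smooth_on_cong[OF D])
  show "smooth_on D (\<lambda>x. \<Sum>i\<in>UNIV. \<Sum>j\<in>UNIV. (a x $ i * b x $ j) *\<^sub>R B x (axis i 1) (axis j 1))"
    by (intro smooth_on_sum smooth_on_scaleR smooth_on_mult smooth_on_vec_nth D a b B)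
qed (simp add: bilinear_eq_sum_axis[OF bil, symmetric])

text \<open>
  Christoffel symbols and curvature are formulated for an arbitrary coordinate expression \<open>G\<close> of a
  metric, the curvature being evaluated on constant vector fields, whose brackets vanish.
\<close>
definition christoffel_of ::
  "(real ^ 'n::finite \<Rightarrow> real ^ 'n \<Rightarrow> real ^ 'n \<Rightarrow> real) \<Rightarrow> real ^ 'n \<Rightarrow>
   real ^ 'n \<Rightarrow> real ^ 'n \<Rightarrow> real ^ 'n"
where
  "christoffel_of G x u v =
     (THE w. \<forall>z. 2 * G x w z = frechet_derivative (\<lambda>y. G y v z) (at x) u
        + frechet_derivative (\<lambda>y. G y u z) (at x) v - frechet_derivative (\<lambda>y. G y u v) (at x) z)"

definition curvature_of ::
  "(real ^ 'n::finite \<Rightarrow> real ^ 'n \<Rightarrow> real ^ 'n \<Rightarrow> real) \<Rightarrow> real ^ 'n \<Rightarrow>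
   real ^ 'n \<Rightarrow> real ^ 'n \<Rightarrow> real ^ 'n \<Rightarrow> real ^ 'n"
where
  "curvature_of G x X Y Z =
     frechet_derivative (\<lambda>y. christoffel_of G y Y Z) (at x) X
   - frechet_derivative (\<lambda>y. christoffel_of G y X Z) (at x) Y
   + christoffel_of G x X (christoffel_of G x Y Z) - christoffel_of G x Y (christoffel_of G x X Z)"

locale local_metric =
  fixes D :: "(real ^ 'n::finite) set" and G :: "real ^ 'n \<Rightarrow> real ^ 'n \<Rightarrow> real ^ 'n \<Rightarrow> real"
  assumes open_D: "open D" and metric: "x \<in> D \<Longrightarrow> metric_form (G x)"
    and smooth: "smooth_on D (\<lambda>x. G x u v)"
begin

abbreviation \<Gamma> where "\<Gamma> \<equiv> christoffel_of G"

definition dG where "dG x w u v = frechet_derivative (\<lambda>y. G y u v) (at x) w"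

lemma G_bilinear: "x \<in> D \<Longrightarrow> bilinear (G x)" and G_sym: "x \<in> D \<Longrightarrow> G x u v = G x v u"
  using metric by (auto simp: metric_form_def)

lemma dG_bilinear: "x \<in> D \<Longrightarrow> bilinear (dG x w)"
  unfolding dG_def
  by (intro bilinear_field_derivative_bilinear[OF open_D] G_bilinear)
     (auto intro: smooth_on_differentiable[OF smooth])

lemma dG_linear: "x \<in> D \<Longrightarrow> linear (\<lambda>w. dG x w u v)"
  unfolding dG_def by (intro linear_frechet_derivative smooth_on_differentiable[OF smooth])

lemmas dG_simps = bilinear_ladd[OF dG_bilinear] bilinear_radd[OF dG_bilinear]
  bilinear_lmul[OF dG_bilinear] bilinear_rmul[OF dG_bilinear]
  linear_add[OF dG_linear] linear_cmul[OF dG_linear]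

lemma dG_sym: assumes "x \<in> D" shows "dG x w u v = dG x w v u"
  unfolding dG_def
  by (subst frechet_derivative_transform_within_open[OF _ open_D assms, of _ "\<lambda>y. G y v u"])
     (auto intro: smooth_on_differentiable[OF smooth] assms G_sym)

lemma koszul_linear:
  assumes "x \<in> D" shows "linear (\<lambda>z. (dG x u v z + dG x v u z - dG x z u v) / 2)"
  using assms by (intro linearI) (simp_all add: dG_simps field_simps)

lemma koszul:
  assumes "x \<in> D"
  shows "G x (\<Gamma> x u v) z = (dG x u v z + dG x v u z - dG x z u v) / 2"
proof -
  have "\<Gamma> x u v = (THE w. \<forall>z. G x w z = (dG x u v z + dG x v u z - dG x z u v) / 2)"
    by (simp add: christoffel_of_def dG_def field_simps)
  then show ?thesis using metric_form.riesz_the[OF metric koszul_linear] assms by simp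
qed

lemma \<Gamma>_sym: assumes "x \<in> D" shows "\<Gamma> x u v = \<Gamma> x v u"
  by (rule metric_form.eqI[OF metric[OF assms]])
     (use assms in \<open>simp add: koszul dG_sym[of x _ u v]\<close>)

lemma \<Gamma>_bilinear: assumes x: "x \<in> D" shows "bilinear (\<Gamma> x)"
proof -
  note e = metric_form.eqI[OF metric[OF x]]
  have "linear (\<lambda>v. \<Gamma> x u v)" for u
    using x by (intro linearI e) (simp_all add: koszul bilinear_ladd[OF G_bilinear]
        bilinear_lmul[OF G_bilinear] dG_simps field_simps)
  moreover from this have "linear (\<lambda>u. \<Gamma> x u v)" for v
    by (subst \<Gamma>_sym[OF x])
  ultimately show ?thesis by (simp add: bilinear_def)
qed

lemma smooth_on_riesz:
  assumes "\<And>x. x \<in> D \<Longrightarrow> linear (\<phi> x)" and \<phi>: "\<And>z. smooth_on D (\<lambda>x. \<phi> x z)"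
    and "\<And>x z. x \<in> D \<Longrightarrow> G x (W x) z = \<phi> x z"
  shows "smooth_on D W"
proof (rule smooth_on_cong[OF open_D])
  let ?M = "\<lambda>x. (\<chi> i j. G x (axis j 1) (axis i 1)) :: real ^ 'n ^ 'n"
  have gram: "metric_form.gram (G x) = ?M x" if "x \<in> D" for x
    by (rule metric_form.gram_def[OF metric[OF that]])
  show "smooth_on D (\<lambda>x. \<chi> k. det (\<chi> i j. if j = k then \<phi> x (axis i 1)
      else G x (axis j 1) (axis i 1)) / det (?M x))"
  proof (intro smooth_on_vec_lambda smooth_on_divide smooth_on_det open_D smooth)
    show "smooth_on D (\<lambda>x. if j = k then \<phi> x (axis i 1) else G x (axis j 1) (axis i 1))" for i j k
      by (cases "j = k") (simp_all add: \<phi> smooth)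
    show "det (?M x) \<noteq> 0" if "x \<in> D" for x
      using metric_form.det_gram[OF metric[OF that]] gram[OF that] by simp
  qed
  show "(\<chi> k. det (\<chi> i j. if j = k then \<phi> x (axis i 1)
      else G x (axis j 1) (axis i 1)) / det (?M x)) = W x" if x: "x \<in> D" for x
    using metric_form.riesz_iff[OF metric[OF x] assms(1)[OF x], of "W x"] assms(3)[OF x] gram[OF x]
    by simp
qed

lemma dG_smooth: "smooth_on D (\<lambda>x. dG x w u v)"
  unfolding dG_def by (intro smooth_on_derivative smooth)

lemma \<Gamma>_smooth: "smooth_on D (\<lambda>x. \<Gamma> x u v)"
  by (rule smooth_on_riesz[OF koszul_linear _ koszul])
     (auto intro!: smooth_on_divide smooth_on_add smooth_on_diff smooth_on_const dG_smooth open_D)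

lemma \<Gamma>_differentiable: "x \<in> D \<Longrightarrow> (\<lambda>x. \<Gamma> x u v) differentiable (at x)"
  by (rule smooth_on_differentiable[OF \<Gamma>_smooth])

lemma d\<Gamma>_sym:
  assumes "x \<in> D"
  shows "frechet_derivative (\<lambda>y. \<Gamma> y u v) (at x) = frechet_derivative (\<lambda>y. \<Gamma> y v u) (at x)"
  by (rule frechet_derivative_transform_within_open[OF \<Gamma>_differentiable open_D])
     (auto intro: assms \<Gamma>_sym)

text \<open>
  This is the statement that the metric is parallel, for constant vector fields.
\<close>
lemma metric_compatible:
  assumes x: "x \<in> D" shows "dG x w u v = G x (\<Gamma> x w u) v + G x u (\<Gamma> x w v)"
  using koszul[OF x, of w u v] koszul[OF x, of w v u] G_sym[OF x, of u "\<Gamma> x w v"]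
    dG_sym[OF x, of w v u] dG_sym[OF x, of u w v] dG_sym[OF x, of v w u]
  by (simp add: field_simps)

text \<open>
  Differentiating \<open>metric_compatible\<close> once more expresses the second derivative of \<open>G y Z W\<close> in the
  directions \<open>Y\<close> and \<open>X\<close>. Its antisymmetric part in \<open>X\<close> and \<open>Y\<close> is zero on the one hand, and on the
  other the sum of the two curvature terms.
\<close>
lemma curvature_of_skew:
  assumes x: "x \<in> D"
  shows "G x (curvature_of G x X Y Z) W = - G x Z (curvature_of G x X Y W)"
proof -
  let ?d = "\<lambda>X Y Z. frechet_derivative (\<lambda>y. \<Gamma> y Y Z) (at x) X"
  have second: "frechet_derivative (\<lambda>y. frechet_derivative (\<lambda>y. G y Z W) (at y) Y) (at x) X
      = G x (\<Gamma> x X (\<Gamma> x Y Z)) W + G x (\<Gamma> x Y Z) (\<Gamma> x X W) + G x (?d X Y Z) W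
      + G x (\<Gamma> x X Z) (\<Gamma> x Y W) + G x Z (\<Gamma> x X (\<Gamma> x Y W)) + G x Z (?d X Y W)" for X Y
  proof -
    have d\<Gamma>: "((\<lambda>y. \<Gamma> y Y Z) has_derivative (\<lambda>X. ?d X Y Z)) (at x)" for Z
      by (rule smooth_on_has_derivative[OF \<Gamma>_smooth x])
    have dd: "((\<lambda>y. G y (p y) (q y)) has_derivative
        (\<lambda>X. dG x X (p x) (q x) + G x (p' X) (q x) + G x (p x) (q' X))) (at x)"
      if "(p has_derivative p') (at x)" "(q has_derivative q') (at x)" for p q p' q'
      using bilinear_field_has_derivative[OF open_D G_bilinear smooth_on_differentiable[OF smooth]
          open_D x _ has_derivative_ident that]
      by (simp add: dG_def)
    have "((\<lambda>y. G y (\<Gamma> y Y Z) W + G y Z (\<Gamma> y Y W)) has_derivative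
      (\<lambda>X. (dG x X (\<Gamma> x Y Z) W + G x (?d X Y Z) W + G x (\<Gamma> x Y Z) 0)
         + (dG x X Z (\<Gamma> x Y W) + G x 0 (\<Gamma> x Y W) + G x Z (?d X Y W)))) (at x)"
      by (intro has_derivative_add dd d\<Gamma> has_derivative_const)
    then have "((\<lambda>y. dG y Y Z W) has_derivative
      (\<lambda>X. (dG x X (\<Gamma> x Y Z) W + G x (?d X Y Z) W + G x (\<Gamma> x Y Z) 0)
         + (dG x X Z (\<Gamma> x Y W) + G x 0 (\<Gamma> x Y W) + G x Z (?d X Y W)))) (at x)"
      by (rule has_derivative_transform_within_open[OF _ open_D x]) (simp add: metric_compatible)
    from fun_cong[OF frechet_derivative_at[OF this], of X] show ?thesis
      by (simp add: dG_def[symmetric] metric_compatible[OF x] bilinear_lzero[OF G_bilinear[OF x]]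
          bilinear_rzero[OF G_bilinear[OF x]])
  qed
  have "frechet_derivative (\<lambda>y. frechet_derivative (\<lambda>y. G y Z W) (at y) Y) (at x) X
      = frechet_derivative (\<lambda>y. frechet_derivative (\<lambda>y. G y Z W) (at y) X) (at x) Y"
    by (rule symmetric_second_derivative[OF open_D x smooth])
  then show ?thesis
    unfolding second curvature_of_def
    by (simp add: bilinear_ladd[OF G_bilinear[OF x]] bilinear_lsub[OF G_bilinear[OF x]]
        bilinear_radd[OF G_bilinear[OF x]] bilinear_rsub[OF G_bilinear[OF x]])
qed

lemma curvature_form:
  assumes x: "x \<in> D" shows "curvature_form (G x) (curvature_of G x)"
proof -
  have bd: "bilinear (\<lambda>u v. frechet_derivative (\<lambda>y. \<Gamma> y u v) (at x) w)" for w
    by (intro bilinear_field_derivative_bilinear[OF open_D x] \<Gamma>_bilinear \<Gamma>_differentiable)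
  have ld: "linear (frechet_derivative (\<lambda>y. \<Gamma> y u v) (at x))" for u v
    by (intro linear_frechet_derivative \<Gamma>_differentiable x)
  note b = \<Gamma>_bilinear[OF x]
  note s = bilinear_ladd[OF b] bilinear_radd[OF b] bilinear_lmul[OF b] bilinear_rmul[OF b]
    bilinear_ladd[OF bd] bilinear_radd[OF bd] bilinear_lmul[OF bd] bilinear_rmul[OF bd]
    linear_add[OF ld] linear_cmul[OF ld]
  show ?thesis
  proof (intro curvature_form.intro curvature_form_axioms.intro metric x)
    show "linear (\<lambda>Y. curvature_of G x X Y Z)" for X Z
      unfolding curvature_of_def by (auto intro!: linearI simp: s algebra_simps)
    show "linear (\<lambda>Z. curvature_of G x X Y Z)" for X Y
      unfolding curvature_of_def by (auto intro!: linearI simp: s algebra_simps)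
    show "curvature_of G x X Y Z = - curvature_of G x Y X Z" for X Y Z
      by (simp add: curvature_of_def)
    show "curvature_of G x X Y Z + curvature_of G x Y Z X + curvature_of G x Z X Y = 0" for X Y Z
      using \<Gamma>_sym[OF x, of X Y] \<Gamma>_sym[OF x, of Y Z] \<Gamma>_sym[OF x, of X Z]
        d\<Gamma>_sym[OF x, of X Y] d\<Gamma>_sym[OF x, of Y Z] d\<Gamma>_sym[OF x, of X Z]
      by (simp add: curvature_of_def)
    show "G x (curvature_of G x X Y Z) W = - G x Z (curvature_of G x X Y W)" for X Y Z W
      by (rule curvature_of_skew[OF x])
  qed
qed

definition scal where "scal x = tr (raise (G x) (ric (curvature_of G x)))"

lemma scal_smooth: "smooth_on D scal"
proof -
  have R: "smooth_on D (\<lambda>x. curvature_of G x X Y Z)" for X Y Z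
    unfolding curvature_of_def
    by (intro smooth_on_add smooth_on_diff smooth_on_derivative \<Gamma>_smooth open_D
        smooth_on_bilinear_field[OF open_D \<Gamma>_bilinear \<Gamma>_smooth] smooth_on_const)
  have S: "smooth_on D (\<lambda>x. ric (curvature_of G x) Y Z)" for Y Z
    unfolding ric_def tr_eq_sum by (intro smooth_on_sum smooth_on_vec_nth R open_D)
  have "smooth_on D (\<lambda>x. raise (G x) (ric (curvature_of G x)) X)" for X
    by (rule smooth_on_riesz[OF _ S])
       (auto intro: curvature_form.S_linear_right[OF curvature_form]
          curvature_form.g_Q[OF curvature_form])
  then show ?thesis
    unfolding scal_def[abs_def] tr_eq_sum by (intro smooth_on_sum smooth_on_vec_nth open_D)
qed

end

section \<open>Change of coordinates\<close>

text \<open>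
  The Ricci tensor at a point is defined in a chart that is chosen anew at every point, so nothing
  can be said about its variation without knowing that curvature is a tensor. This is proved here
  for a local isometry \<open>T\<close> between coordinate domains.
\<close>
locale local_isometry = src: local_metric D G + tgt: local_metric D' G'
  for D :: "(real ^ 'n::finite) set" and G and D' :: "(real ^ 'n) set" and G' +
  fixes T :: "real ^ 'n \<Rightarrow> real ^ 'n"
  assumes T_smooth: "smooth_on D T" and T_image: "T ` D \<subseteq> D'"
    and T_inj: "x \<in> D \<Longrightarrow> inj (frechet_derivative T (at x))"
    and isometric: "x \<in> D \<Longrightarrow>
      G x u v = G' (T x) (frechet_derivative T (at x) u) (frechet_derivative T (at x) v)"
begin

abbreviation J where "J x u \<equiv> frechet_derivative T (at x) u"

definition dJ where "dJ x u v = frechet_derivative (\<lambda>y. J y v) (at x) u"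

lemma T_in: "x \<in> D \<Longrightarrow> T x \<in> D'"
  using T_image by blast

lemma J_linear: "x \<in> D \<Longrightarrow> linear (J x)"
  by (rule linear_frechet_derivative[OF smooth_on_differentiable[OF T_smooth]])

lemma J_surj: assumes "x \<in> D" shows "\<exists>u. v = J x u"
  using linear_injective_imp_surjective[OF J_linear T_inj, OF assms assms] by (metis surjD)

lemma dJ_sym: "x \<in> D \<Longrightarrow> dJ x u v = dJ x v u"
  unfolding dJ_def by (rule symmetric_second_derivative[OF src.open_D _ T_smooth])

lemma J_has_derivative: "x \<in> D \<Longrightarrow> ((\<lambda>y. J y v) has_derivative (\<lambda>u. dJ x u v)) (at x)"
  unfolding dJ_def by (rule smooth_on_has_derivative[OF smooth_on_derivative[OF T_smooth]])

lemma dG_transform: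
  assumes x: "x \<in> D"
  shows "src.dG x w u v = tgt.dG (T x) (J x w) (J x u) (J x v)
    + G' (T x) (dJ x w u) (J x v) + G' (T x) (J x u) (dJ x w v)"
proof -
  have "((\<lambda>y. G' (T y) (J y u) (J y v)) has_derivative
      (\<lambda>w. tgt.dG (T x) (J x w) (J x u) (J x v)
        + G' (T x) (dJ x w u) (J x v) + G' (T x) (J x u) (dJ x w v))) (at x)"
    unfolding tgt.dG_def
    by (intro bilinear_field_has_derivative[OF tgt.open_D tgt.G_bilinear
          smooth_on_differentiable[OF tgt.smooth] src.open_D x T_image]
        J_has_derivative x smooth_on_has_derivative[OF T_smooth])
  then have "((\<lambda>y. G y u v) has_derivative
      (\<lambda>w. tgt.dG (T x) (J x w) (J x u) (J x v)
        + G' (T x) (dJ x w u) (J x v) + G' (T x) (J x u) (dJ x w v))) (at x)"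
    by (rule has_derivative_transform_within_open[OF _ src.open_D x]) (rule isometric[symmetric])
  from fun_cong[OF frechet_derivative_at[OF this, symmetric]] show ?thesis
    unfolding src.dG_def .
qed

text \<open>
  The second derivative of the coordinate change measures how far the Christoffel symbols are from
  being a tensor. To see it, \<open>dG_transform\<close> is inserted into the Koszul formula; by the symmetry of
  second derivatives all terms with \<open>dJ\<close> cancel except those that contain \<open>dJ x u v\<close>.
\<close>
lemma christoffel_transform:
  assumes x: "x \<in> D"
  shows "J x (src.\<Gamma> x u v) = tgt.\<Gamma> (T x) (J x u) (J x v) + dJ x u v"
proof (rule metric_form.eqI[OF tgt.metric[OF T_in[OF x]]])
  fix Z
  obtain z where z: "Z = J x z" using J_surj[OF x] by blast
  note G'_sym = tgt.G_sym[OF T_in[OF x]]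
  have "G' (T x) (J x (src.\<Gamma> x u v)) Z = G x (src.\<Gamma> x u v) z"
    by (simp add: z isometric[OF x])
  also have "\<dots> = (tgt.dG (T x) (J x u) (J x v) (J x z) + tgt.dG (T x) (J x v) (J x u) (J x z)
      - tgt.dG (T x) (J x z) (J x u) (J x v)) / 2 + G' (T x) (dJ x u v) (J x z)"
    unfolding src.koszul[OF x] dG_transform[OF x]
    using dJ_sym[OF x, of v u] dJ_sym[OF x, of z u] dJ_sym[OF x, of z v]
      G'_sym[of "dJ x u z" "J x v"]
    by (simp add: field_simps)
  also have "\<dots> = G' (T x) (tgt.\<Gamma> (T x) (J x u) (J x v) + dJ x u v) Z"
    by (simp add: z tgt.koszul[OF T_in[OF x]] bilinear_ladd[OF tgt.G_bilinear[OF T_in[OF x]]])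
  finally show "G' (T x) (J x (src.\<Gamma> x u v)) Z =
      G' (T x) (tgt.\<Gamma> (T x) (J x u) (J x v) + dJ x u v) Z" .
qed

lemma J_apply_has_derivative:
  assumes x: "x \<in> D" and b: "(b has_derivative b') (at x)"
  shows "((\<lambda>y. J y (b y)) has_derivative (\<lambda>w. dJ x w (b x) + J x (b' w))) (at x)"
proof -
  \<comment> \<open>The product rule for bilinear fields applies after adding a dummy second argument, of which
      only one coordinate is used and which is kept constant with this coordinate equal to 1.\<close>
  fix i :: 'n
  have "((\<lambda>y. axis i 1 $ i *\<^sub>R J y (b y)) has_derivative
      (\<lambda>w. frechet_derivative (\<lambda>y. axis i 1 $ i *\<^sub>R J y (b x)) (at x) w
        + axis i 1 $ i *\<^sub>R J x (b' w) + 0 $ i *\<^sub>R J x (b x))) (at x)"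
  proof (rule bilinear_field_has_derivative[where B = "\<lambda>y u c. c $ i *\<^sub>R J y u" and D = D and N = D
        and h = "\<lambda>y. y" and a = b and b = "\<lambda>_. axis i 1" and a' = b' and b' = "\<lambda>_. 0"])
    show "bilinear (\<lambda>u c. c $ i *\<^sub>R J y u)" if "y \<in> D" for y
      unfolding bilinear_def using J_linear[OF that]
      by (auto intro!: linearI simp: linear_add linear_cmul algebra_simps)
    show "(\<lambda>y. c $ i *\<^sub>R J y u) differentiable (at y)" if "y \<in> D" for y u c
      using has_derivative_scaleR_right[OF J_has_derivative[OF that]] differentiable_def by blast
  qed (use x b src.open_D in auto)
  then show ?thesis by (simp add: dJ_def)
qed

text \<open>
  The derivative of the law for the Christoffel symbols is antisymmetrized. The third derivatives of
  \<open>T\<close> drop out by symmetry, and the terms with one second derivative are cancelled by those that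
  arise when the law is applied to the quadratic terms of the curvature.
\<close>
lemma curvature_transform:
  assumes x: "x \<in> D"
  shows "J x (curvature_of G x u v w) = curvature_of G' (T x) (J x u) (J x v) (J x w)"
proof -
  let ?d = "\<lambda>u v w. frechet_derivative (\<lambda>y. src.\<Gamma> y v w) (at x) u"
  let ?d' = "\<lambda>u v w. frechet_derivative (\<lambda>y. tgt.\<Gamma> y v w) (at (T x)) u"
  let ?ddJ = "\<lambda>u v w. frechet_derivative (\<lambda>y. dJ y v w) (at x) u"
  have ddJ_sym: "?ddJ u v w = ?ddJ v u w" for u v w
    unfolding dJ_def
    by (rule symmetric_second_derivative[OF src.open_D x smooth_on_derivative[OF T_smooth]])
  have deriv: "dJ x u (src.\<Gamma> x v w) + J x (?d u v w) = ?d' (J x u) (J x v) (J x w)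
      + tgt.\<Gamma> (T x) (dJ x u v) (J x w) + tgt.\<Gamma> (T x) (J x v) (dJ x u w) + ?ddJ u v w" for u v w
  proof -
    have "((\<lambda>y. tgt.\<Gamma> (T y) (J y v) (J y w) + dJ y v w) has_derivative
        (\<lambda>u. (?d' (J x u) (J x v) (J x w) + tgt.\<Gamma> (T x) (dJ x u v) (J x w)
          + tgt.\<Gamma> (T x) (J x v) (dJ x u w)) + ?ddJ u v w)) (at x)"
    proof (intro has_derivative_add)
      show "((\<lambda>y. dJ y v w) has_derivative (\<lambda>u. ?ddJ u v w)) (at x)"
        unfolding dJ_def
        by (rule smooth_on_has_derivative[OF smooth_on_derivative[OF smooth_on_derivative[OF T_smooth]] x])
    qed (intro bilinear_field_has_derivative[OF tgt.open_D tgt.\<Gamma>_bilinear tgt.\<Gamma>_differentiable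
          src.open_D x T_image] J_has_derivative x smooth_on_has_derivative[OF T_smooth])
    then have "((\<lambda>y. J y (src.\<Gamma> y v w)) has_derivative
        (\<lambda>u. (?d' (J x u) (J x v) (J x w) + tgt.\<Gamma> (T x) (dJ x u v) (J x w)
          + tgt.\<Gamma> (T x) (J x v) (dJ x u w)) + ?ddJ u v w)) (at x)"
      by (rule has_derivative_transform_within_open[OF _ src.open_D x])
         (rule christoffel_transform[symmetric])
    from has_derivative_unique[OF this
        J_apply_has_derivative[OF x smooth_on_has_derivative[OF src.\<Gamma>_smooth x]]]
    show ?thesis by metis
  qed
  have deriv': "J x (?d u v w) = ?d' (J x u) (J x v) (J x w) + tgt.\<Gamma> (T x) (dJ x u v) (J x w)
      + tgt.\<Gamma> (T x) (J x v) (dJ x u w) + ?ddJ u v w - dJ x u (src.\<Gamma> x v w)" for u v w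
    using deriv[where u = u and v = v and w = w] by (simp add: eq_diff_eq add.commute)
  note b = tgt.\<Gamma>_bilinear[OF T_in[OF x]]
  have quad: "J x (src.\<Gamma> x u (src.\<Gamma> x v w)) = tgt.\<Gamma> (T x) (J x u) (tgt.\<Gamma> (T x) (J x v) (J x w))
      + tgt.\<Gamma> (T x) (J x u) (dJ x v w) + dJ x u (src.\<Gamma> x v w)" for u v w
    by (simp add: christoffel_transform[OF x] bilinear_radd[OF b])
  have "J x (curvature_of G x u v w) = J x (?d u v w) - J x (?d v u w)
      + J x (src.\<Gamma> x u (src.\<Gamma> x v w)) - J x (src.\<Gamma> x v (src.\<Gamma> x u w))"
    using J_linear[OF x] by (simp add: curvature_of_def linear_add linear_diff)
  also have "\<dots> = curvature_of G' (T x) (J x u) (J x v) (J x w)"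
    unfolding quad deriv' curvature_of_def
    using ddJ_sym[where u = u and v = v and w = w] dJ_sym[OF x, of u v]
    by simp
  finally show ?thesis .
qed

lemma scal_transform:
  assumes x: "x \<in> D" shows "src.scal x = tgt.scal (T x)"
proof -
  interpret s: curvature_form "G x" "curvature_of G x"
    by (rule src.curvature_form[OF x])
  interpret t: curvature_form "G' (T x)" "curvature_of G' (T x)"
    by (rule tgt.curvature_form[OF T_in[OF x]])
  have S: "s.S v w = t.S (J x v) (J x w)" for v w
    unfolding ric_def
    by (rule tr_conjugate[OF J_linear[OF x] T_inj[OF x] s.R_linear1 t.R_linear1])
       (rule curvature_transform[OF x])
  have "J x (s.Q v) = t.Q (J x v)" for v
  proof (rule t.eqI)
    fix Z
    obtain z where "Z = J x z" using J_surj[OF x] by blast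
    then show "G' (T x) (J x (s.Q v)) Z = G' (T x) (t.Q (J x v)) Z"
      by (simp add: isometric[OF x, symmetric] s.g_Q t.g_Q S)
  qed
  then show ?thesis
    unfolding src.scal_def tgt.scal_def
    by (rule tr_conjugate[OF J_linear[OF x] T_inj[OF x] s.Q_linear t.Q_linear])
qed

end

section \<open>From charts to the manifold\<close>

locale semi_riemannian =
  fixes M :: "'a topology" and A :: "('a, 'n::finite) chart set" and g :: "('a, 'n) form2"
  assumes manifold: "semi_riemannian_manifold M A g"
begin

lemma chart: "c \<in> A \<Longrightarrow> is_chart M c"
  and charts_cover: "(\<Union>c\<in>A. fst c) = topspace M"
  and transition_smooth: "c \<in> A \<Longrightarrow> d \<in> A \<Longrightarrow> smooth_on (snd c ` (fst c \<inter> fst d)) (transition c d)"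
  using manifold unfolding semi_riemannian_manifold_def smooth_manifold_def by blast+

lemma g_metric: "p \<in> topspace M \<Longrightarrow> metric_form (g p)"
  using manifold unfolding semi_riemannian_manifold_def metric_form_def by blast

lemma chart_at: assumes "p \<in> topspace M" shows "chart_at A p \<in> A" "p \<in> fst (chart_at A p)"
  using someI_ex[of "\<lambda>c. c \<in> A \<and> p \<in> fst c"] charts_cover assms unfolding chart_at_def by blast+

lemma chart_subset: "c \<in> A \<Longrightarrow> fst c \<subseteq> topspace M"
  using charts_cover by blast

lemma chart_homeomorphic:
  "c \<in> A \<Longrightarrow> homeomorphic_map (subtopology M (fst c)) (top_of_set (snd c ` fst c)) (snd c)"
  and chart_image_open: "c \<in> A \<Longrightarrow> open (snd c ` fst c)"
  and chart_domain_open: "c \<in> A \<Longrightarrow> openin M (fst c)"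
  using chart unfolding is_chart_def by blast+

lemma coords_inv: assumes "c \<in> A" "p \<in> fst c" shows "coords_inv c (snd c p) = p"
proof -
  have "inj_on (snd c) (fst c)"
    using homeomorphic_imp_injective_map[OF chart_homeomorphic[OF assms(1)]]
      chart_subset[OF assms(1)] by (simp add: Int_absorb1)
  then show ?thesis unfolding coords_inv_def using assms(2) by (rule inv_into_f_f)
qed

lemma chart_open_image:
  assumes c: "c \<in> A" and "openin M W" "W \<subseteq> fst c"
  shows "open (snd c ` W)"
proof -
  have "openin (subtopology M (fst c)) W"
    using assms(2,3) chart_domain_open[OF c] by (simp add: openin_open_subtopology)
  then have "openin (top_of_set (snd c ` fst c)) (snd c ` W)"
    using homeomorphic_imp_open_map[OF chart_homeomorphic[OF c]] by (simp add: open_map_def)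
  then show ?thesis using chart_image_open[OF c] openin_open_eq by blast
qed

lemma transition: "c \<in> A \<Longrightarrow> p \<in> fst c \<Longrightarrow> transition c d (snd c p) = snd d p"
  by (simp add: transition_def coords_inv)

lemma coord_change_has_derivative:
  assumes "c \<in> A" "d \<in> A" "p \<in> fst c" "p \<in> fst d"
  shows "(transition c d has_derivative coord_change c d p) (at (snd c p))"
  unfolding coord_change_def[abs_def]
  by (rule smooth_on_has_derivative[OF transition_smooth[OF assms(1,2)]]) (use assms in blast)

lemma coord_change_linear:
  "c \<in> A \<Longrightarrow> d \<in> A \<Longrightarrow> p \<in> fst c \<Longrightarrow> p \<in> fst d \<Longrightarrow> linear (coord_change c d p)"
  using coord_change_has_derivative has_derivative_linear by blast

lemma coord_change_compose:
  assumes c: "c \<in> A" "p \<in> fst c" and d: "d \<in> A" "p \<in> fst d" and e: "e \<in> A" "p \<in> fst e"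
  shows "coord_change d e p (coord_change c d p v) = coord_change c e p v"
proof -
  let ?W = "fst c \<inter> fst d \<inter> fst e"
  have "open (snd c ` ?W)"
    using chart_domain_open c d e by (intro chart_open_image openin_Int) auto
  moreover have "(transition d e \<circ> transition c d has_derivative
      coord_change d e p \<circ> coord_change c d p) (at (snd c p))"
    using coord_change_has_derivative[of c d p] coord_change_has_derivative[of d e p] c d e
    by (intro diff_chain_at) (auto simp: transition)
  ultimately have "(transition c e has_derivative coord_change d e p \<circ> coord_change c d p)
      (at (snd c p))"
    using c d e by (elim has_derivative_transform_within_open[where s = "snd c ` ?W"])
      (auto simp: transition)
  from has_derivative_unique[OF this coord_change_has_derivative] c e show ?thesis
    by (metis comp_apply)
qed

lemma coord_change_self:
  assumes "c \<in> A" "p \<in> fst c" shows "coord_change c c p v = v"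
proof -
  have "(transition c c has_derivative (\<lambda>v. v)) (at (snd c p))"
    by (rule has_derivative_transform_within_open[OF has_derivative_ident
          chart_image_open[OF assms(1)]]) (use assms in \<open>auto simp: transition\<close>)
  from has_derivative_unique[OF this coord_change_has_derivative] assms show ?thesis by metis
qed

lemma coord_change_inj:
  assumes "c \<in> A" "d \<in> A" "p \<in> fst c" "p \<in> fst d" shows "inj (coord_change c d p)"
  by (rule inj_on_inverseI[where g = "coord_change d c p"])
     (use assms in \<open>simp add: coord_change_compose coord_change_self\<close>)

lemma local_form2:
  "c \<in> A \<Longrightarrow> p \<in> fst c \<Longrightarrow> local_form2 A c g (snd c p) u v =
    g p (coord_change c (chart_at A p) p u) (coord_change c (chart_at A p) p v)"
  by (simp add: local_form2_def coords_inv)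

lemma local_form2_chart_at:
  assumes "p \<in> topspace M"
  shows "local_form2 A (chart_at A p) g (snd (chart_at A p) p) = g p"
  using chart_at[OF assms] by (intro ext) (simp add: local_form2 coord_change_self)

lemma metric_form_local_form2:
  assumes c: "c \<in> A" and p: "p \<in> fst c"
  shows "metric_form (local_form2 A c g (snd c p))"
proof -
  have M: "p \<in> topspace M" using chart_subset[OF c] p by blast
  note e = chart_at[OF M]
  interpret metric_form "g p" by (rule g_metric[OF M])
  note lin = coord_change_linear[OF c e(1) p e(2)]
  show ?thesis
  proof unfold_locales
    show "bilinear (local_form2 A c g (snd c p))"
      unfolding bilinear_def local_form2[OF c p]
      by (auto intro!: linearI simp: g_simps linear_add[OF lin] linear_cmul[OF lin])
    show "local_form2 A c g (snd c p) X Y = local_form2 A c g (snd c p) Y X" for X Y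
      by (simp add: local_form2[OF c p] sym)
    show "X = 0" if "\<And>Y. local_form2 A c g (snd c p) X Y = 0" for X
    proof -
      have "coord_change c (chart_at A p) p X = 0"
      proof (rule nondeg)
        fix W
        have "W = coord_change c (chart_at A p) p (coord_change (chart_at A p) c p W)"
          using c p e by (simp add: coord_change_compose coord_change_self)
        then show "g p (coord_change c (chart_at A p) p X) W = 0"
          using that local_form2[OF c p] by metis
      qed
      then show ?thesis
        using coord_change_inj[OF c e(1) p e(2)] lin by (metis linear_injective_0)
    qed
  qed
qed

lemma local_metric_subset:
  assumes c: "c \<in> A" and D: "open D" "D \<subseteq> snd c ` fst c"
  shows "local_metric D (local_form2 A c g)"
proof (rule local_metric.intro)
  show "open D" by (rule D(1))
  show "metric_form (local_form2 A c g x)" if "x \<in> D" for x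
    using that D(2) metric_form_local_form2[OF c] by blast
  show "smooth_on D (\<lambda>x. local_form2 A c g x u v)" for u v
    using manifold c D(2) smooth_on_subset unfolding semi_riemannian_manifold_def by blast
qed

lemmas local_metric = local_metric_subset[OF _ chart_image_open order_refl]

lemma local_isometry_transition:
  assumes c: "c \<in> A" and d: "d \<in> A"
  shows "local_isometry (snd c ` (fst c \<inter> fst d)) (local_form2 A c g)
    (snd d ` fst d) (local_form2 A d g) (transition c d)"
proof (intro local_isometry.intro local_isometry_axioms.intro)
  show "local_metric (snd c ` (fst c \<inter> fst d)) (local_form2 A c g)"
    using chart_domain_open c d
    by (intro local_metric_subset chart_open_image openin_Int) auto
  show "local_metric (snd d ` fst d) (local_form2 A d g)"
    by (rule local_metric[OF d d])
  show "smooth_on (snd c ` (fst c \<inter> fst d)) (transition c d)"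
    by (rule transition_smooth[OF c d])
  show "transition c d ` snd c ` (fst c \<inter> fst d) \<subseteq> snd d ` fst d"
    using c by (auto simp: transition)
  fix x assume "x \<in> snd c ` (fst c \<inter> fst d)"
  then obtain p where p: "p \<in> fst c" "p \<in> fst d" and x: "x = snd c p" by blast
  have D: "frechet_derivative (transition c d) (at x) = coord_change c d p"
    by (simp add: x coord_change_def[abs_def])
  show "inj (frechet_derivative (transition c d) (at x))"
    unfolding D by (rule coord_change_inj[OF c d p])
  have M: "p \<in> topspace M" using chart_subset[OF c] p by blast
  show "local_form2 A c g x u v = local_form2 A d g (transition c d x)
      (frechet_derivative (transition c d) (at x) u) (frechet_derivative (transition c d) (at x) v)"
    for u v
    unfolding D using c d p chart_at[OF M] by (simp add: x transition local_form2 coord_change_compose)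
qed

text \<open>
  For constant fields the bracket term of the curvature vanishes, and an inner covariant derivative
  is just a Christoffel symbol.
\<close>
lemma curvature_eq:
  assumes p: "p \<in> topspace M"
  shows "curvature A g p = curvature_of (local_form2 A (chart_at A p) g) (snd (chart_at A p) p)"
proof -
  define c where "c = chart_at A p"
  have c: "c \<in> A" "p \<in> fst c" unfolding c_def by (rule chart_at[OF p])+
  interpret local_metric "snd c ` fst c" "local_form2 A c g" by (rule local_metric[OF c(1) c(1)])
  have \<Gamma>: "christoffel A g c = \<Gamma>"
    by (intro ext) (simp add: christoffel_def christoffel_of_def)
  have \<nabla>: "levi_civita A g c (\<lambda>_. Y) Z = (\<lambda>x. frechet_derivative Z (at x) Y + \<Gamma> x Y (Z x))" for Y Z
    by (simp add: levi_civita_def[abs_def] \<Gamma>)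
  have "\<Gamma> (snd c p) 0 Z = 0" for Z
    using c(2) by (intro bilinear_lzero \<Gamma>_bilinear) blast
  then have "levi_civita A g c (lie_bracket (\<lambda>_. X) (\<lambda>_. Y)) (\<lambda>_. Z) (snd c p) = 0" for X Y Z
    by (simp add: levi_civita_def lie_bracket_def \<Gamma>)
  then show ?thesis
    unfolding c_def[symmetric]
    by (intro ext) (simp add: curvature_def c_def[symmetric] local_curvature_def \<nabla> curvature_of_def)
qed

lemma curvature_form_at:
  assumes p: "p \<in> topspace M"
  shows "curvature_form (g p) (curvature A g p)"
  using local_metric.curvature_form[OF local_metric[OF chart_at(1) chart_at(1)], OF p p, of "snd (chart_at A p) p"]
    chart_at(2)[OF p]
  by (simp add: curvature_eq[OF p] local_form2_chart_at[OF p])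

lemma ricci_eq: "ricci A g p = ric (curvature A g p)"
  by (intro ext) (simp add: ricci_def ric_def tr_def)

lemma ricci_op_eq: "ricci_op A g p = raise (g p) (ric (curvature A g p))"
  by (intro ext) (simp add: ricci_op_def raise_def ricci_eq)

lemma scalar_curvature_eq: "scalar_curvature A g p = tr (raise (g p) (ric (curvature A g p)))"
  by (simp add: scalar_curvature_def tr_def ricci_op_eq)

lemma T_tensor_eq:
  assumes "p \<in> topspace M"
  shows "T_tensor A g a p = curvature_form.T (g p) (curvature A g p) a"
  by (intro ext) (simp add: curvature_form.T_def[OF curvature_form_at[OF assms]] T_tensor_def
      ricci_eq ricci_op_eq scalar_curvature_eq)

text \<open>
  Near \<open>p\<close> the scalar curvature can be computed in one fixed chart, although its definition uses a
  different chart at every point.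
\<close>
lemma scalar_curvature_chart:
  assumes c: "c \<in> A" and p: "p \<in> fst c"
  shows "scalar_curvature A g p = local_metric.scal (local_form2 A c g) (snd c p)"
proof -
  have M: "p \<in> topspace M" using chart_subset[OF c] p by blast
  note e = chart_at[OF M]
  interpret iso: local_isometry "snd c ` (fst c \<inter> fst (chart_at A p))" "local_form2 A c g"
      "snd (chart_at A p) ` fst (chart_at A p)" "local_form2 A (chart_at A p) g"
      "transition c (chart_at A p)"
    by (rule local_isometry_transition[OF c e(1)])
  have "iso.src.scal (snd c p) = iso.tgt.scal (snd (chart_at A p) p)"
    using iso.scal_transform[of "snd c p"] p e c by (simp add: transition)
  then show ?thesis
    by (simp add: scalar_curvature_eq curvature_eq[OF M] iso.tgt.scal_def local_form2_chart_at[OF M])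
qed

lemma scalar_curvature_affine_smooth:
  "smooth_function_on A (topspace M) (\<lambda>p. q * scalar_curvature A g p + s)"
  unfolding smooth_function_on_def
proof
  fix c assume c: "c \<in> A"
  interpret local_metric "snd c ` fst c" "local_form2 A c g" by (rule local_metric[OF c c])
  have "smooth_on (snd c ` fst c) (\<lambda>x. q * scal x + s)"
    by (intro smooth_on_add smooth_on_mult smooth_on_const scal_smooth open_D)
  then have "smooth_on (snd c ` fst c) ((\<lambda>p. q * scalar_curvature A g p + s) \<circ> coords_inv c)"
    by (rule smooth_on_cong[OF open_D]) (auto simp: coords_inv[OF c] scalar_curvature_chart[OF c])
  then show "smooth_on (snd c ` (fst c \<inter> topspace M))
      ((\<lambda>p. q * scalar_curvature A g p + s) \<circ> coords_inv c)"
    using chart_subset[OF c] by (simp add: Int_absorb2)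
qed

end

theorem theorem4p6:
  fixes M :: "'a topology" and A :: "('a, 'n::finite) chart set"
    and g :: "('a, 'n) form2" and k \<epsilon> :: real and \<xi> :: "'a \<Rightarrow> real ^ 'n"
    and a :: "nat \<Rightarrow> real" and L :: "'a \<Rightarrow> real"
  assumes "N_semi_riemannian_manifold M A g k \<epsilon> \<xi>"
    and "a 0 + a 5 + a 6 \<noteq> 0"
    and "T_pseudosymmetric M A g a L"
    and "T_support M A g a \<noteq> {} \<longrightarrow> (\<exists>p\<in>T_support M A g a. L p \<noteq> 0)"
  shows "(a 0 + a 2 + a 3 + real CARD('n) * a 4 + a 5 + a 6 \<noteq> 0 \<longrightarrow>
            (\<forall>p\<in>topspace M. einstein_at A g p \<or> (p \<in> T_support M A g a \<and> L p = k)))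
       \<and> (a 0 + a 2 + a 3 + real CARD('n) * a 4 + a 5 + a 6 = 0 \<longrightarrow>
            (\<exists>\<alpha> \<beta>. smooth_function_on A (topspace M) \<alpha> \<and> smooth_function_on A (topspace M) \<beta> \<and>
               (\<forall>p\<in>topspace M. eta_einstein_at A g \<epsilon> \<xi> \<alpha> \<beta> p \<or>
                                 (p \<in> T_support M A g a \<and> L p = k))))"
proof -
  interpret semi_riemannian M A g
    using assms(1) by unfold_locales (simp add: N_semi_riemannian_manifold_def)
  have nf: "nullity_form (g p) (curvature A g p) (\<xi> p) k \<epsilon>" if p: "p \<in> topspace M" for p
  proof (intro nullity_form.intro curvature_form_at nullity_form_axioms.intro p)
    show "\<epsilon> \<in> {1, -1}" "g p (\<xi> p) (\<xi> p) = \<epsilon>"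
      using assms(1) p unfolding N_semi_riemannian_manifold_def by blast+
    show "curvature A g p X Y (\<xi> p) = k *\<^sub>R (g p Y (\<xi> p) *\<^sub>R X - g p X (\<xi> p) *\<^sub>R Y)" for X Y
      using assms(1) p unfolding N_semi_riemannian_manifold_def nullity_def by blast
  qed
  \<comment> \<open>Where the tensor is zero the invariance is trivial, so both alternatives to \<open>L p = k\<close> lead to
      the same algebra.\<close>
  have inv: "endo_act (wedge (g p) (\<xi> p) X) (curvature_form.T (g p) (curvature A g p) a) U V W = 0"
    if p: "p \<in> topspace M" and "\<not> (p \<in> T_support M A g a \<and> L p = k)" for p X U V W
  proof (cases "p \<in> T_support M A g a")
    case True
    then have "L p \<noteq> k" using that by blast
    moreover have "endo_act (curvature A g p Z X) (T_tensor A g a p) U V W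
        = L p *\<^sub>R endo_act (wedge (g p) Z X) (T_tensor A g a p) U V W" for U V W Z X
      using assms(3) True unfolding T_pseudosymmetric_def by blast
    ultimately show ?thesis
      unfolding T_tensor_eq[OF p] by (rule nullity_form.xi_wedge_invariant[OF nf[OF p], rotated])
  next
    case False
    then have "curvature_form.T (g p) (curvature A g p) a X Y Z = 0" for X Y Z
      using p by (simp add: T_support_def T_tensor_eq[OF p])
    then show ?thesis
      by (simp add: endo_act_def linear_0[OF nullity_form.wedge_linear[OF nf[OF p]]])
  qed
  define \<kappa> where "\<kappa> = k * (real CARD('n) - 1)"
  define \<alpha> where "\<alpha> = (\<lambda>p. (scalar_curvature A g p - \<kappa>) / (real CARD('n) - 1))"
  define \<beta> where "\<beta> = (\<lambda>p. \<epsilon> * (\<kappa> - \<alpha> p))"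
  show ?thesis
  proof (intro conjI impI ballI)
    fix p assume c: "a 0 + a 2 + a 3 + real CARD('n) * a 4 + a 5 + a 6 \<noteq> 0" and p: "p \<in> topspace M"
    show "einstein_at A g p \<or> (p \<in> T_support M A g a \<and> L p = k)"
      using nullity_form.einstein_from_contraction[OF nf[OF p] inv[OF p] c]
      unfolding einstein_at_def ricci_eq scalar_curvature_eq by blast
  next
    assume c: "a 0 + a 2 + a 3 + real CARD('n) * a 4 + a 5 + a 6 = 0"
    have "eta_einstein_at A g \<epsilon> \<xi> \<alpha> \<beta> p \<or> (p \<in> T_support M A g a \<and> L p = k)"
      if p: "p \<in> topspace M" for p
      using nullity_form.eta_einstein[OF nf[OF p] inv[OF p] assms(2) c]
      unfolding eta_einstein_at_def ricci_eq scalar_curvature_eq eta_def \<alpha>_def \<beta>_def \<kappa>_def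
        nullity_form.\<kappa>_def[OF nf[OF p]] by blast
    moreover have "\<alpha> = (\<lambda>p. 1 / (real CARD('n) - 1) * scalar_curvature A g p
          + - \<kappa> / (real CARD('n) - 1))"
      by (simp add: \<alpha>_def fun_eq_iff diff_divide_distrib)
    then have "smooth_function_on A (topspace M) \<alpha>"
      by (simp only: scalar_curvature_affine_smooth)
    moreover have "\<beta> = (\<lambda>p. - \<epsilon> / (real CARD('n) - 1) * scalar_curvature A g p
          + \<epsilon> * (\<kappa> + \<kappa> / (real CARD('n) - 1)))"
      by (simp add: \<alpha>_def \<beta>_def fun_eq_iff diff_divide_distrib algebra_simps)
    then have "smooth_function_on A (topspace M) \<beta>"
      by (simp only: scalar_curvature_affine_smooth)
    ultimately show "\<exists>\<alpha> \<beta>. smooth_function_on A (topspace M) \<alpha> \<and> smooth_function_on A (topspace M) \<beta> \<and>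
        (\<forall>p\<in>topspace M. eta_einstein_at A g \<epsilon> \<xi> \<alpha> \<beta> p \<or> (p \<in> T_support M A g a \<and> L p = k))"
      by blast
  qed
qed

end
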